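(* Let $(A_0,A_1)$ be a quasi-Banach couple such that $A_0\cap A_1$ is not closed in $A_0+A_1$. Let $\theta\in(0,1)$ and assume that $0<p,q\le\infty$ are such that $(A_0,A_1)_{\theta,p}\neq (A_0,A_1)_{\theta,q}$, and that $r_1,r_2\in[q,p]$, $r_1\neq r_2$. Then $$(A_0,A_1)_{\theta,r_1}\neq (A_0,A_1)_{\theta,r_2}.$$
   Context: A quasi-Banach couple $(A_0,A_1)$ consists of two quasi-Banach spaces (complete quasi-normed spaces) continuously embedded in a common Hausdorff topological vector space. For $x\in A_0+A_1$ and $t>0$, $K(x,t,A_0,A_1)=\inf\{\|a_0\|_{A_0}+t\|a_1\|_{A_1}: x=a_0+a_1,\ a_j\in A_j,\ j=0,1\}$. The sum carries the quasi-norm $\|x\|_{A_0+A_1}=K(x,1,A_0,A_1)$. For $0<\theta<1$ and $0<p\le\infty$, $(A_0,A_1)_{\theta,p}$ is the space of all $x\in A_0+A_1$ for which $\|x\|_{(A_0,A_1)_{\theta,p}}=\left(\int_0^\infty (t^{-\theta}K(x,t,A_0,A_1))^p\frac{dt}{t}\right)^{1/p}$ (if $p<\infty$) or $\sup_{0<t<\infty}t^{-\theta}K(x,t,A_0,A_1)$ (if $p=\infty$) is finite. Equality of such spaces means equality as sets (the quasi-norms are then automatically equivalent). The interval $[q,p]$ is taken in $(0,\infty]$. *)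

theory Defs
  imports "HOL-Analysis.Analysis" "HOL-Library.Set_Algebras"
begin

class hausdorff_real_tvs = real_vector + topological_ab_group_add + t2_space +
  assumes tendsto_scaleR_tvs:
    "((\<lambda>z. fst z *\<^sub>R snd z) \<longlongrightarrow> a *\<^sub>R x) (nhds a \<times>\<^sub>F nhds x)"

instance real_normed_vector \<subseteq> hausdorff_real_tvs
proof
  fix a :: real and x :: 'a
  show "((\<lambda>z. fst z *\<^sub>R snd z) \<longlongrightarrow> a *\<^sub>R x) (nhds a \<times>\<^sub>F nhds x)"
    by (intro tendsto_scaleR filterlim_fst filterlim_snd)
qed

text \<open>A space is a subset \<open>A\<close> of an ambient real vector space together with a function \<open>n\<close>
  of which only the values on \<open>A\<close> matter; a continuous embedding into the ambient space becomes an inclusion.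
  Real scalars also cover complex spaces, by restriction of scalars.\<close>

definition quasi_norm_on :: "'v::real_vector set \<Rightarrow> ('v \<Rightarrow> real) \<Rightarrow> bool" where
  "quasi_norm_on A n \<longleftrightarrow> subspace A \<and>
     (\<forall>x\<in>A. 0 \<le> n x) \<and>
     (\<forall>x\<in>A. n x = 0 \<longleftrightarrow> x = 0) \<and>
     (\<forall>c. \<forall>x\<in>A. n (c *\<^sub>R x) = \<bar>c\<bar> * n x) \<and>
     (\<exists>C\<ge>1. \<forall>x\<in>A. \<forall>y\<in>A. n (x + y) \<le> C * (n x + n y))"

definition quasi_Banach :: "'v::real_vector set \<Rightarrow> ('v \<Rightarrow> real) \<Rightarrow> bool" where
  "quasi_Banach A n \<longleftrightarrow> quasi_norm_on A n \<and>
     (\<forall>u :: nat \<Rightarrow> 'v. range u \<subseteq> A \<longrightarrow>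
        (\<forall>e>0. \<exists>N. \<forall>i\<ge>N. \<forall>j\<ge>N. n (u i - u j) < e) \<longrightarrow>
        (\<exists>l\<in>A. (\<lambda>k. n (u k - l)) \<longlonglongrightarrow> 0))"

text \<open>Balls of a quasi-norm need not be open, so a set is declared open
  if it contains a ball around each of its points.\<close>

definition quasi_norm_topology :: "'v::real_vector set \<Rightarrow> ('v \<Rightarrow> real) \<Rightarrow> 'v topology" where
  "quasi_norm_topology A n =
     topology (\<lambda>U. U \<subseteq> A \<and> (\<forall>x\<in>U. \<exists>e>0. \<forall>y\<in>A. n (y - x) < e \<longrightarrow> y \<in> U))"

lemma openin_quasi_norm_topology:
  "openin (quasi_norm_topology A n) U \<longleftrightarrow>
     U \<subseteq> A \<and> (\<forall>x\<in>U. \<exists>e>0. \<forall>y\<in>A. n (y - x) < e \<longrightarrow> y \<in> U)"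
proof -
  have "istopology (\<lambda>U. U \<subseteq> A \<and> (\<forall>x\<in>U. \<exists>e>0. \<forall>y\<in>A. n (y - x) < e \<longrightarrow> y \<in> U))"
    unfolding istopology_def
  proof (intro conjI allI impI ballI)
    fix S T x
    assume S: "S \<subseteq> A \<and> (\<forall>x\<in>S. \<exists>e>0. \<forall>y\<in>A. n (y - x) < e \<longrightarrow> y \<in> S)"
      and T: "T \<subseteq> A \<and> (\<forall>x\<in>T. \<exists>e>0. \<forall>y\<in>A. n (y - x) < e \<longrightarrow> y \<in> T)"
      and x: "x \<in> S \<inter> T"
    obtain d where d: "d > 0" "\<forall>y\<in>A. n (y - x) < d \<longrightarrow> y \<in> S" using S x by blast
    obtain e where e: "e > 0" "\<forall>y\<in>A. n (y - x) < e \<longrightarrow> y \<in> T" using T x by blast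
    show "\<exists>e>0. \<forall>y\<in>A. n (y - x) < e \<longrightarrow> y \<in> S \<inter> T"
      using d e by (intro exI[of _ "min d e"]) auto
  next
    fix K x
    assume K: "\<forall>S\<in>K. S \<subseteq> A \<and> (\<forall>x\<in>S. \<exists>e>0. \<forall>y\<in>A. n (y - x) < e \<longrightarrow> y \<in> S)"
      and x: "x \<in> \<Union>K"
    then obtain S where S: "S \<in> K" "x \<in> S" by blast
    with K obtain e where "e > 0" "\<forall>y\<in>A. n (y - x) < e \<longrightarrow> y \<in> S" by blast
    with S show "\<exists>e>0. \<forall>y\<in>A. n (y - x) < e \<longrightarrow> y \<in> \<Union>K"
      by (intro exI[of _ e]) auto
  qed auto
  then show ?thesis
    by (simp add: quasi_norm_topology_def)
qed

definition quasi_Banach_couple ::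
  "'v::hausdorff_real_tvs set \<Rightarrow> ('v \<Rightarrow> real) \<Rightarrow> 'v set \<Rightarrow> ('v \<Rightarrow> real) \<Rightarrow> bool" where
  "quasi_Banach_couple A0 n0 A1 n1 \<longleftrightarrow>
     quasi_Banach A0 n0 \<and> quasi_Banach A1 n1 \<and>
     continuous_map (quasi_norm_topology A0 n0) euclidean (\<lambda>x. x) \<and>
     continuous_map (quasi_norm_topology A1 n1) euclidean (\<lambda>x. x)"

definition K_functional ::
  "'v::real_vector set \<Rightarrow> ('v \<Rightarrow> real) \<Rightarrow> 'v set \<Rightarrow> ('v \<Rightarrow> real) \<Rightarrow> 'v \<Rightarrow> real \<Rightarrow> real" where
  "K_functional A0 n0 A1 n1 x t =
     Inf {n0 a0 + t * n1 a1 | a0 a1. a0 \<in> A0 \<and> a1 \<in> A1 \<and> x = a0 + a1}"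

definition sum_quasi_norm ::
  "'v::real_vector set \<Rightarrow> ('v \<Rightarrow> real) \<Rightarrow> 'v set \<Rightarrow> ('v \<Rightarrow> real) \<Rightarrow> 'v \<Rightarrow> real" where
  "sum_quasi_norm A0 n0 A1 n1 x = K_functional A0 n0 A1 n1 x 1"

text \<open>Real power of an extended nonnegative real, for exponents \<open>s > 0\<close> only.\<close>

definition ennreal_powr :: "ennreal \<Rightarrow> real \<Rightarrow> ennreal" where
  "ennreal_powr u s = (if u = \<infinity> then \<infinity> else ennreal (enn2real u powr s))"

definition interp_quasi_norm ::
  "'v::real_vector set \<Rightarrow> ('v \<Rightarrow> real) \<Rightarrow> 'v set \<Rightarrow> ('v \<Rightarrow> real) \<Rightarrow> real \<Rightarrow> ennreal \<Rightarrow> 'v \<Rightarrow> ennreal" where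
  "interp_quasi_norm A0 n0 A1 n1 \<theta> p x =
     (if p = \<infinity> then SUP t\<in>{0<..}. ennreal (t powr (-\<theta>) * K_functional A0 n0 A1 n1 x t)
      else ennreal_powr
        (\<integral>\<^sup>+ t\<in>{0<..}. ennreal ((t powr (-\<theta>) * K_functional A0 n0 A1 n1 x t) powr enn2real p / t) \<partial>lborel)
        (1 / enn2real p))"

definition interp_space ::
  "'v::real_vector set \<Rightarrow> ('v \<Rightarrow> real) \<Rightarrow> 'v set \<Rightarrow> ('v \<Rightarrow> real) \<Rightarrow> real \<Rightarrow> ennreal \<Rightarrow> 'v set" where
  "interp_space A0 n0 A1 n1 \<theta> p = {x \<in> A0 + A1. interp_quasi_norm A0 n0 A1 n1 \<theta> p x < \<infinity>}"

end

theory Submission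
  imports Defs
begin

text \<open>
  Put \<open>f\<^sub>x(k) = 2\<^bsup>-\<theta>k\<^esup> K(x, 2\<^bsup>k\<^esup>)\<close> for integers \<open>k\<close>, so that \<open>x\<close> lies in the space with exponent \<open>r\<close>
  iff \<open>f\<^sub>x\<close> lies in \<open>\<ell>\<^sup>r\<close>. Call \<open>k\<close> a peak of \<open>f\<^sub>x\<close> if \<open>f\<^sub>x(j) \<le> 2\<^bsup>\<eta>|j-k|\<^esup> f\<^sub>x(k)\<close> for all \<open>j\<close>. A bounded \<open>f\<^sub>x\<close> is
  dominated by exponentially decaying bumps centred at its peaks; with finitely many peaks it is in every \<open>\<ell>\<^sup>r\<close>.
  Hence two different spaces yield an \<open>x\<close> whose \<open>f\<^sub>x\<close> is bounded and has infinitely many peaks, without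
  loss of generality (exchanging \<open>A0\<close> and \<open>A1\<close>) unbounded above.

  At a peak \<open>k\<close> the difference of near-optimal decompositions of \<open>x\<close> at the times \<open>2\<^bsup>k+L\<^esup>\<close> and \<open>2\<^bsup>k-L\<^esup>\<close> is a
  block \<open>b\<^sub>k\<close> in \<open>A0 \<inter> A1\<close>; \<open>f\<^sub>b\<close> is comparable to \<open>f\<^sub>x(k)\<close> at \<open>k\<close> and decays exponentially away from \<open>k\<close>.
  Along sufficiently separated peaks \<open>p\<^sub>i\<close>, the sum \<open>y\<close> of the normalised blocks with weights
  \<open>\<mu>\<^sub>i = (i+1)\<^bsup>-1/r1\<^esup>\<close> converges in \<open>A1\<close>, the blocks hardly interact, and \<open>f\<^sub>y\<close> looks like a copy of \<open>\<mu>\<close>.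
  So \<open>y\<close> distinguishes the exponent \<open>r1\<close> from every larger one.
\<close>

subsection \<open>Sequence spaces and peaks\<close>

text \<open>It is applied to nonnegative \<open>f\<close>, so a bound from above is the right
  condition at \<open>r = \<infinity>\<close>. Integration over counting measure makes sense on
  every index set without a summability premise.\<close>

definition mem_ell :: "ennreal \<Rightarrow> ('i \<Rightarrow> real) \<Rightarrow> 'i set \<Rightarrow> bool" where
  "mem_ell r f I \<longleftrightarrow>
     (if r = \<infinity> then bdd_above (f ` I)
      else (\<integral>\<^sup>+i. ennreal (f i powr enn2real r) \<partial>count_space I) < \<infinity>)"

text \<open>A single term of a sum of powers is at most the whole sum. This supplies the boundedness
  that the search for peaks relies on.\<close>

lemma mem_ell_bdd_above:
  assumes r: "0 < r" and f: "mem_ell r f I"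
  shows "bdd_above (f ` I)"
proof (cases "r = \<infinity>")
  case False
  define s where "s = enn2real r"
  have s: "0 < s"
    using r False by (simp add: s_def enn2real_positive_iff top.not_eq_extremum)
  define S where "S = (\<integral>\<^sup>+i. ennreal (f i powr s) \<partial>count_space I)"
  have fin: "S < \<infinity>" using f False by (simp add: mem_ell_def s_def S_def)
  have "f i \<le> enn2real S powr (1/s)" if i: "i \<in> I" for i
  proof (cases "f i > 0")
    case True
    have "ennreal (f i powr s) \<le> S"
      unfolding S_def using nn_integral_ge_point[OF i] .
    then have "f i powr s \<le> enn2real S" using fin
      by (metis enn2real_ennreal enn2real_mono powr_ge_zero infinity_ennreal_def)
    then have "(f i powr s) powr (1/s) \<le> enn2real S powr (1/s)"
      using s by (intro powr_mono2) auto
    with True s show ?thesis by (simp add: powr_powr)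
  qed (use powr_ge_zero[of "enn2real S" "1/s"] in linarith)
  then show ?thesis by (auto intro!: bdd_aboveI)
qed (use f in \<open>simp add: mem_ell_def\<close>)

lemma mem_ell_reindex:
  assumes "bij_betw h I J"
  shows "mem_ell r (\<lambda>i. f (h i)) I \<longleftrightarrow> mem_ell r f J"
proof -
  have "(\<lambda>i. f (h i)) ` I = f ` J"
    using assms by (auto simp: bij_betw_def)
  moreover have "(\<integral>\<^sup>+i. ennreal (f (h i) powr enn2real r) \<partial>count_space I)
      = (\<integral>\<^sup>+i. ennreal (f i powr enn2real r) \<partial>count_space J)"
    using nn_integral_bij_count_space[OF assms] .
  ultimately show ?thesis by (simp add: mem_ell_def)
qed

text \<open>Injectivity of \<open>h\<close> makes the sum over \<open>I\<close> a part of the sum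
  over \<open>J\<close>. It serves to show that values of \<open>f\<close> at selected positions are
  already too large for a given exponent.\<close>

lemma mem_ell_comparison:
  assumes f: "mem_ell r f J" and r: "0 < r" and h: "inj_on h I" "h ` I \<subseteq> J" and D: "0 \<le> D"
    and f0: "\<And>j. j \<in> J \<Longrightarrow> 0 \<le> f j"
    and g: "\<And>i. i \<in> I \<Longrightarrow> 0 \<le> g i" "\<And>i. i \<in> I \<Longrightarrow> g i \<le> D * f (h i)"
  shows "mem_ell r g I"
proof (cases "r = \<infinity>")
  case True
  then obtain M where M: "\<And>j. j \<in> J \<Longrightarrow> f j \<le> M"
    using f by (auto simp: mem_ell_def bdd_above_def)
  have "g i \<le> D * M" if "i \<in> I" for i
    using g(2)[OF that] mult_left_mono[OF M D, of "h i"] that h(2) by force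
  then show ?thesis using True by (auto simp: mem_ell_def bdd_above_def)
next
  case False
  define s where "s = enn2real r"
  have s: "0 < s"
    using r False by (simp add: s_def enn2real_positive_iff top.not_eq_extremum)
  have "(\<integral>\<^sup>+i. ennreal (g i powr s) \<partial>count_space I)
      \<le> (\<integral>\<^sup>+i. ennreal (D powr s) * ennreal (f (h i) powr s) \<partial>count_space I)"
  proof (rule nn_integral_mono)
    fix i assume "i \<in> space (count_space I)"
    then have i: "i \<in> I" by simp
    then have "g i powr s \<le> (D * f (h i)) powr s"
      using g s by (intro powr_mono2) auto
    also have "\<dots> = D powr s * f (h i) powr s"
      using D f0 h(2) i by (intro powr_mult)
    finally show "ennreal (g i powr s) \<le> ennreal (D powr s) * ennreal (f (h i) powr s)"
      by (simp add: ennreal_leI flip: ennreal_mult)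
  qed
  also have "\<dots> = ennreal (D powr s) * (\<integral>\<^sup>+i. ennreal (f (h i) powr s) \<partial>count_space I)"
    by (rule nn_integral_cmult) simp
  also have "(\<integral>\<^sup>+i. ennreal (f (h i) powr s) \<partial>count_space I) = (\<integral>\<^sup>+j. ennreal (f j powr s) \<partial>count_space (h ` I))"
    using h(1) by (intro nn_integral_bij_count_space) (simp add: bij_betw_def)
  also have "\<dots> = (\<integral>\<^sup>+j. ennreal (f j powr s) * indicator (h ` I) j \<partial>count_space J)"
    using h(2) by (subst (1 2) nn_integral_count_space_indicator)
      (auto intro!: nn_integral_cong simp: indicator_def image_subset_iff)
  also have "\<dots> \<le> (\<integral>\<^sup>+j. ennreal (f j powr s) \<partial>count_space J)"
    by (intro nn_integral_mono) (auto simp: indicator_def)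
  finally have "(\<integral>\<^sup>+i. ennreal (g i powr s) \<partial>count_space I)
      \<le> ennreal (D powr s) * (\<integral>\<^sup>+j. ennreal (f j powr s) \<partial>count_space J)"
    by (simp add: mult_left_mono)
  also have "\<dots> < \<infinity>"
    using f False by (simp add: ennreal_mult_less_top mem_ell_def s_def)
  finally show ?thesis using False by (simp add: mem_ell_def s_def)
qed

lemma nn_integral_two_sided_geometric:
  assumes a: "0 < a"
  shows "(\<integral>\<^sup>+k. ennreal (2 powr (- a * \<bar>real_of_int k\<bar>)) \<partial>count_space UNIV) < \<infinity>"
proof -
  define g where "g k = ennreal (2 powr (- a * \<bar>real_of_int k\<bar>))" for k :: int
  have half: "(\<integral>\<^sup>+k. g k \<partial>count_space (h ` UNIV)) < \<infinity>"
    if h: "inj h" "\<And>n. \<bar>h n\<bar> = int n" for h :: "nat \<Rightarrow> int"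
  proof -
    have "(\<integral>\<^sup>+k. g k \<partial>count_space (h ` UNIV)) = (\<integral>\<^sup>+n. g (h n) \<partial>count_space UNIV)"
      using h(1) by (intro nn_integral_bij_count_space[symmetric]) (simp add: bij_betw_def)
    also have "\<dots> = (\<Sum>n. g (h n))" by (rule nn_integral_count_space_nat)
    also have "\<dots> = (\<Sum>n. ennreal ((2 powr - a) ^ n))"
    proof -
      have "g (h n) = ennreal ((2 powr - a) ^ n)" for n
      proof -
        have "\<bar>real_of_int (h n)\<bar> = real n"
          using h(2)[of n] by (metis of_int_abs of_int_of_nat_eq)
        then show ?thesis by (simp add: g_def powr_powr flip: powr_realpow)
      qed
      then show ?thesis by simp
    qed
    also have "\<dots> < \<infinity>"
    proof -
      have "(2::real) powr - a < 1" using a powr_less_mono[of "-a" 0 2] by simp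
      then have "summable (\<lambda>n. (2 powr - a) ^ n)" by (intro summable_geometric) auto
      then show ?thesis by (subst suminf_ennreal2) auto
    qed
    finally show ?thesis .
  qed
  \<comment> \<open>The two halves share \<open>0\<close>; counting it twice is harmless in an upper
    bound.\<close>
  have cov: "(UNIV::int set) = range int \<union> range (\<lambda>n. - int n)"
    by (auto intro: int_cases2)
  have "(\<integral>\<^sup>+k. g k \<partial>count_space UNIV)
     \<le> (\<integral>\<^sup>+k. g k * indicator (range int) k + g k * indicator (range (\<lambda>n. - int n)) k \<partial>count_space UNIV)"
    using cov by (intro nn_integral_mono) (auto simp: indicator_def)
  also have "\<dots> = (\<integral>\<^sup>+k. g k \<partial>count_space (range int)) + (\<integral>\<^sup>+k. g k \<partial>count_space (range (\<lambda>n. - int n)))"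
    by (subst nn_integral_add) (auto simp: nn_integral_count_space_indicator)
  also have "\<dots> < \<infinity>"
    using half[of int] half[of "\<lambda>n. - int n"] by (simp add: inj_def)
  finally show ?thesis by (simp add: g_def)
qed

text \<open>For finite \<open>r\<close>, the power of \<open>f k\<close> is bounded by the power of
  one bump, hence by the sum over all bumps. Tonelli, for countable \<open>I\<close>, then sums each
  bump over \<open>k\<close> first, at the same cost \<open>E\<close> for every bump. No triangle
  inequality for the sequence space is involved, so exponents below \<open>1\<close> are
  covered.\<close>

lemma mem_ell_envelope:
  fixes f :: "int \<Rightarrow> real" and p :: "'i \<Rightarrow> int"
  assumes I: "countable I" and r: "0 < r" and d: "0 < d" and D: "0 \<le> D"
    and g0: "\<And>i. i \<in> I \<Longrightarrow> 0 \<le> g i" and f0: "\<And>k. 0 \<le> f k"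
    and g: "mem_ell r g I"
    and fg: "\<And>k. \<exists>i\<in>I. f k \<le> D * (g i * 2 powr (- d * \<bar>real_of_int (k - p i)\<bar>))"
  shows "mem_ell r f UNIV"
proof (cases "r = \<infinity>")
  case True
  then obtain M where M: "\<And>i. i \<in> I \<Longrightarrow> g i \<le> M"
    using g by (auto simp: mem_ell_def bdd_above_def)
  have "f k \<le> D * (M * 1)" for k
  proof -
    obtain i where i: "i \<in> I" "f k \<le> D * (g i * 2 powr (- d * \<bar>real_of_int (k - p i)\<bar>))"
      using fg by blast
    have "2 powr (- d * \<bar>real_of_int (k - p i)\<bar>) \<le> 2 powr 0"
      using d by (intro powr_mono) auto
    then have "g i * 2 powr (- d * \<bar>real_of_int (k - p i)\<bar>) \<le> M * 1"
      using M[OF i(1)] g0[OF i(1)] by (intro mult_mono) auto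
    then show ?thesis using i(2) D by (meson mult_left_mono order_trans)
  qed
  then show ?thesis using True by (auto simp: mem_ell_def bdd_above_def)
next
  case False
  define s where "s = enn2real r"
  have s: "0 < s"
    using r False by (simp add: s_def enn2real_positive_iff top.not_eq_extremum)
  define e where "e k = ennreal (2 powr (- (d * s) * \<bar>real_of_int k\<bar>))" for k
  define h where "h i k = ennreal (D powr s) * (ennreal (g i powr s) * e (k - p i))" for i k
  define E where "E = (\<integral>\<^sup>+k. e k \<partial>count_space UNIV)"
  have E: "E < \<infinity>" unfolding E_def e_def
    using nn_integral_two_sided_geometric[of "d * s"] d s by simp
  have shift: "(\<integral>\<^sup>+k. e (k - m) \<partial>count_space UNIV) = E" for m
  proof -
    have "bij_betw (\<lambda>k. k - m) UNIV (UNIV::int set)"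
      by (rule bij_betwI[where g = "\<lambda>k. k + m"]) auto
    then show ?thesis unfolding E_def by (rule nn_integral_bij_count_space)
  qed
  have pt: "ennreal (f k powr s) \<le> (\<integral>\<^sup>+i. h i k \<partial>count_space I)" for k
  proof -
    obtain i where i: "i \<in> I" "f k \<le> D * (g i * 2 powr (- d * \<bar>real_of_int (k - p i)\<bar>))"
      using fg by blast
    have "f k powr s \<le> (D * (g i * 2 powr (- d * \<bar>real_of_int (k - p i)\<bar>))) powr s"
      using i(2) f0 s by (intro powr_mono2) auto
    also have "\<dots> = D powr s * (g i powr s * 2 powr (- (d * s) * \<bar>real_of_int (k - p i)\<bar>))"
      using D g0[OF i(1)] by (simp add: powr_mult powr_powr algebra_simps)
    finally have "ennreal (f k powr s) \<le> h i k"
      by (simp add: h_def e_def ennreal_leI flip: ennreal_mult)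
    also have "\<dots> \<le> (\<integral>\<^sup>+i. h i k \<partial>count_space I)"
      using nn_integral_ge_point[OF i(1), of "\<lambda>i. h i k"] .
    finally show ?thesis .
  qed
  have "(\<integral>\<^sup>+k. ennreal (f k powr s) \<partial>count_space UNIV)
      \<le> (\<integral>\<^sup>+k. (\<integral>\<^sup>+i. h i k \<partial>count_space I) \<partial>count_space UNIV)"
    by (intro nn_integral_mono pt)
  also have "\<dots> = (\<integral>\<^sup>+i. (\<integral>\<^sup>+k. h i k \<partial>count_space UNIV) \<partial>count_space I)"
    by (intro nn_integral_count_space_nn_integral I) auto
  also have "\<dots> = (\<integral>\<^sup>+i. (ennreal (D powr s) * E) * ennreal (g i powr s) \<partial>count_space I)"
    by (simp add: h_def nn_integral_cmult shift mult_ac)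
  also have "\<dots> = (ennreal (D powr s) * E) * (\<integral>\<^sup>+i. ennreal (g i powr s) \<partial>count_space I)"
    by (rule nn_integral_cmult) simp
  also have "\<dots> < \<infinity>"
    using E g False by (simp add: ennreal_mult_less_top mem_ell_def s_def)
  finally show ?thesis using False by (simp add: mem_ell_def s_def)
qed

definition peak :: "real \<Rightarrow> (int \<Rightarrow> real) \<Rightarrow> int \<Rightarrow> bool" where
  "peak \<eta> f k \<longleftrightarrow> (\<forall>j. f j * 2 powr (- \<eta> * \<bar>real_of_int (j - k)\<bar>) \<le> f k)"

text \<open>With \<open>k\<close> fixed, maximise over \<open>j\<close> the value \<open>f j\<close>
  damped exponentially in the distance from \<open>k\<close>. Boundedness of \<open>f\<close>
  confines the competition to a finite window, and the triangle inequality for distances makes the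
  maximiser a peak.\<close>

lemma peak_exists:
  fixes f :: "int \<Rightarrow> real"
  assumes f: "\<And>k. 0 < f k" "bdd_above (range f)" and \<eta>: "0 < \<eta>"
  shows "\<exists>p. peak \<eta> f p \<and> f k \<le> f p * 2 powr (- \<eta> * \<bar>real_of_int (k - p)\<bar>)"
proof -
  define g where "g j = f j * 2 powr (- \<eta> * \<bar>real_of_int (k - j)\<bar>)" for j
  obtain M where M: "\<And>j. f j \<le> M" using f(2) by (auto simp: bdd_above_def)
  then have M0: "0 < M" using f(1) less_le_trans by blast
  define S where "S = {j. g k \<le> g j}"
  \<comment> \<open>Beyond distance \<open>N\<close> from \<open>k\<close>, even the upper bound
    \<open>M\<close> falls below \<open>f k\<close> once damped.\<close>
  define N where "N = \<lceil>log 2 (M / f k) / \<eta>\<rceil>"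
  have "S \<subseteq> {k - N..k + N}"
  proof
    fix j assume "j \<in> S"
    then have "f k \<le> f j * 2 powr (- \<eta> * \<bar>real_of_int (k - j)\<bar>)"
      by (simp add: S_def g_def)
    also have "\<dots> \<le> M * 2 powr (- \<eta> * \<bar>real_of_int (k - j)\<bar>)"
      by (intro mult_right_mono M) auto
    finally have "2 powr (\<eta> * \<bar>real_of_int (k - j)\<bar>) \<le> M / f k"
      using f(1)[of k] by (simp add: powr_minus field_simps)
    then have "\<eta> * \<bar>real_of_int (k - j)\<bar> \<le> log 2 (M / f k)"
      using f(1)[of k] M0 by (subst le_log_iff) auto
    then have "real_of_int \<bar>k - j\<bar> \<le> log 2 (M / f k) / \<eta>"
      using \<eta> by (simp add: field_simps)
    then have "\<bar>k - j\<bar> \<le> N" unfolding N_def by linarith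
    then show "j \<in> {k - N..k + N}" by auto
  qed
  then have fin: "finite S" by (rule finite_subset) simp
  have kS: "k \<in> S" by (simp add: S_def)
  have "Max (g ` S) \<in> g ` S" using fin kS by (intro Max_in) auto
  then obtain p where p: "p \<in> S" "\<And>j. j \<in> S \<Longrightarrow> g j \<le> g p"
    using Max_ge[of "g ` S"] fin by fastforce
  have gp: "g j \<le> g p" for j
    using p(2)[of j] p(2)[OF kS] by (cases "j \<in> S") (auto simp: S_def)
  have "f j * 2 powr (- \<eta> * \<bar>real_of_int (j - p)\<bar>) \<le> f p" for j
  proof -
    have tri: "\<bar>real_of_int (k - j)\<bar> \<le> \<bar>real_of_int (j - p)\<bar> + \<bar>real_of_int (k - p)\<bar>" by linarith
    have "f j * 2 powr (- \<eta> * \<bar>real_of_int (j - p)\<bar>) * 2 powr (- \<eta> * \<bar>real_of_int (k - p)\<bar>)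
       = f j * 2 powr (- \<eta> * (\<bar>real_of_int (j - p)\<bar> + \<bar>real_of_int (k - p)\<bar>))"
      by (simp add: ring_distribs flip: powr_add)
    also have "\<dots> \<le> g j"
    proof -
      have le: "- \<eta> * (\<bar>real_of_int (j - p)\<bar> + \<bar>real_of_int (k - p)\<bar>) \<le> - \<eta> * \<bar>real_of_int (k - j)\<bar>"
        using mult_left_mono[OF tri less_imp_le[OF \<eta>]] by (simp only: mult_minus_left neg_le_iff_le)
      then show ?thesis
        unfolding g_def by (intro mult_left_mono powr_mono le less_imp_le[OF f(1)]) simp
    qed
    also have "\<dots> \<le> f p * 2 powr (- \<eta> * \<bar>real_of_int (k - p)\<bar>)" using gp by (simp add: g_def)
    finally show ?thesis by (simp only: mult_le_cancel_right_pos powr_gt_zero zero_neq_numeral simp_thms)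
  qed
  moreover have "f k \<le> g p" using gp[of k] by (simp add: g_def)
  ultimately show ?thesis unfolding peak_def g_def by blast
qed

text \<open>The peaks are the centres of an envelope, and finitely many heights are summable to any
  power. Read contrapositively, a bounded positive \<open>f\<close> outside one sequence space has
  infinitely many peaks.\<close>

lemma finitely_many_peaks_mem_ell:
  fixes f :: "int \<Rightarrow> real"
  assumes f: "\<And>k. 0 < f k" "bdd_above (range f)" and \<eta>: "0 < \<eta>"
    and fin: "finite {k. peak \<eta> f k}" and r: "0 < r"
  shows "mem_ell r f UNIV"
proof (rule mem_ell_envelope[where I = "{k. peak \<eta> f k}" and p = "\<lambda>k. k" and g = f and D = 1])
  show "mem_ell r f {k. peak \<eta> f k}"
    using fin by (auto simp: mem_ell_def nn_integral_count_space_finite ennreal_powr_def)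
next
  fix k
  show "\<exists>i\<in>{k. peak \<eta> f k}. f k \<le> 1 * (f i * 2 powr (- \<eta> * \<bar>real_of_int (k - i)\<bar>))"
    using peak_exists[OF f \<eta>, of k] by auto
qed (use f fin \<eta> r in \<open>auto intro: countable_finite less_imp_le\<close>)

text \<open>At exponent \<open>r1\<close> the powers form the harmonic series; at a larger finite
  exponent they form a convergent series, and the terms themselves are at most
  \<open>1\<close>.\<close>

lemma mem_ell_inverse_powr:
  assumes r: "0 < r1" "r1 < r2"
  defines "\<mu> \<equiv> \<lambda>i::nat. real (Suc i) powr (- 1 / enn2real r1)"
  shows "\<not> mem_ell r1 \<mu> UNIV" and "mem_ell r2 \<mu> UNIV"
proof -
  define s where "s = enn2real r1"
  have top: "r1 \<noteq> \<infinity>" using r by auto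
  have s: "0 < s"
    using r top by (simp add: s_def enn2real_positive_iff top.not_eq_extremum)
  have sm: "summable (\<lambda>i. real (Suc i) powr a) \<longleftrightarrow> a < -1" for a
    using summable_real_powr_iff[of a] summable_Suc_iff[of "\<lambda>i. real i powr a"] by simp
  have nn: "(\<integral>\<^sup>+i. ennreal (\<mu> i powr t) \<partial>count_space UNIV) = (\<Sum>i. ennreal (real (Suc i) powr (- t / s)))" for t
    unfolding nn_integral_count_space_nat \<mu>_def s_def by (simp add: powr_powr)
  have "(\<Sum>i. ennreal (real (Suc i) powr (- 1))) = \<infinity>"
  proof (rule ccontr)
    assume "\<not> ?thesis"
    then have "summable (\<lambda>i. real (Suc i) powr (-1))"
      by (intro summable_suminf_not_top) auto
    then show False using sm[of "-1"] by simp
  qed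
  then show "\<not> mem_ell r1 \<mu> UNIV"
    using nn[of s] s top by (simp add: mem_ell_def s_def)
  show "mem_ell r2 \<mu> UNIV"
  proof (cases "r2 = \<infinity>")
    case True
    have "\<mu> i \<le> 1" for i
      unfolding \<mu>_def using s powr_mono[of "-1/s" 0 "real (Suc i)"] by (simp add: s_def)
    then show ?thesis using True by (auto simp: mem_ell_def bdd_above_def)
  next
    case False
    then have "s < enn2real r2"
      using r unfolding s_def by (intro enn2real_less_iff[THEN iffD2]) (auto simp: top.not_eq_extremum ennreal_enn2real_if)
    then have "summable (\<lambda>i. real (Suc i) powr (- enn2real r2 / s))"
      using s by (subst sm) (simp add: field_simps)
    then have "(\<Sum>i. ennreal (real (Suc i) powr (- enn2real r2 / s))) < \<infinity>"
      by (subst suminf_ennreal2) auto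
    then show ?thesis using False nn[of "enn2real r2"] by (simp add: mem_ell_def)
  qed
qed

subsection \<open>Discretisation\<close>

text \<open>The height \<open>a k / 2 powr k\<close> on an interval of length
  \<open>2 powr k\<close> imitates, up to a factor \<open>2\<close>, the density of the measure
  dt/t.\<close>

lemma nn_integral_dyadic_step:
  fixes a :: "int \<Rightarrow> real"
  assumes "\<And>k. 0 \<le> a k"
  shows "(\<integral>\<^sup>+t. (\<integral>\<^sup>+k. ennreal (a k / 2 powr k) * indicator {2 powr k..<2 * 2 powr k} t \<partial>count_space UNIV) \<partial>lborel)
       = (\<integral>\<^sup>+k. ennreal (a k) \<partial>count_space UNIV)"
proof -
  have "(\<integral>\<^sup>+t. ennreal (a k / 2 powr k) * indicator {2 powr k..<2 * 2 powr k} t \<partial>lborel) = ennreal (a k)" for k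
  proof -
    have "(\<integral>\<^sup>+t. ennreal (a k / 2 powr k) * indicator {2 powr k..<2 * 2 powr k} t \<partial>lborel)
        = ennreal (a k / 2 powr k) * ennreal (2 * 2 powr k - 2 powr k)"
      by (subst nn_integral_cmult_indicator) auto
    also have "\<dots> = ennreal (a k / 2 powr k * 2 powr k)"
      using assms[of k] by (subst ennreal_mult[symmetric]) auto
    finally show ?thesis by simp
  qed
  then show ?thesis
    by (subst nn_integral_count_space_nn_integral) (auto simp: atLeastLessThan_def)
qed

text \<open>The dyadic intervals partition the positive half-line, so only the index
  \<open>m\<close> contributes at \<open>t\<close>.\<close>

lemma dyadic_step_eval:
  fixes a :: "int \<Rightarrow> real"
  assumes t: "0 < t"
  defines "m \<equiv> \<lfloor>log 2 t\<rfloor>"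
  shows "(\<integral>\<^sup>+k. ennreal (a k / 2 powr k) * indicator {2 powr k..<2 * 2 powr k} t \<partial>count_space UNIV)
       = ennreal (a m / 2 powr m)"
    and "2 powr m \<le> t" and "t < 2 * 2 powr m"
proof -
  have iff: "t \<in> {2 powr k..<2 * 2 powr k} \<longleftrightarrow> k = m" for k :: int
  proof -
    have "2 * 2 powr real_of_int k = 2 powr (real_of_int k + 1)" by (simp add: powr_add)
    then have "t \<in> {2 powr k..<2 * 2 powr k} \<longleftrightarrow> real_of_int k \<le> log 2 t \<and> log 2 t < real_of_int k + 1"
      using t by (simp add: le_log_iff log_less_iff)
    then show ?thesis unfolding m_def by linarith
  qed
  then have "t \<in> {2 powr m..<2 * 2 powr m}" by blast
  then show "2 powr m \<le> t" "t < 2 * 2 powr m" by auto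
  have "(\<integral>\<^sup>+k. ennreal (a k / 2 powr k) * indicator {2 powr k..<2 * 2 powr k} t \<partial>count_space UNIV)
      = (\<integral>\<^sup>+k. ennreal (a m / 2 powr m) * indicator {m} k \<partial>count_space UNIV)"
    using iff by (intro nn_integral_cong) (auto simp: indicator_def)
  then show "(\<integral>\<^sup>+k. ennreal (a k / 2 powr k) * indicator {2 powr k..<2 * 2 powr k} t \<partial>count_space UNIV)
       = ennreal (a m / 2 powr m)"
    by (simp add: nn_integral_cmult_indicator)
qed

text \<open>\<open>F\<close> is nondecreasing and \<open>F t / t\<close> is nonincreasing. So within
  an octave \<open>F\<close> at most doubles, while the power of \<open>t\<close> drops by a factor
  of at most \<open>2 powr \<theta>\<close>.\<close>

lemma dyadic_comparison:
  fixes F :: "real \<Rightarrow> real"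
  assumes F0: "\<And>t. 0 < t \<Longrightarrow> 0 \<le> F t"
    and mono: "\<And>u t. 0 < u \<Longrightarrow> u \<le> t \<Longrightarrow> F u \<le> F t"
    and quasiconcave: "\<And>u t. 0 < u \<Longrightarrow> u \<le> t \<Longrightarrow> u * F t \<le> t * F u"
    and \<theta>: "0 < \<theta>" and u: "0 < u" "u \<le> t" "t \<le> 2 * u"
  shows "t powr (-\<theta>) * F t \<le> 2 * (u powr (-\<theta>) * F u)"
    and "2 powr (-\<theta>) * (u powr (-\<theta>) * F u) \<le> t powr (-\<theta>) * F t"
proof -
  have "u * F t \<le> u * (2 * F u)"
    using quasiconcave[OF u(1,2)] mult_right_mono[OF u(3) F0[OF u(1)]] by (simp add: mult_ac)
  then have "F t \<le> 2 * F u" using u(1) by simp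
  moreover have "t powr (-\<theta>) \<le> u powr (-\<theta>)" using u \<theta> by (intro powr_mono2') auto
  ultimately have "t powr (-\<theta>) * F t \<le> u powr (-\<theta>) * (2 * F u)"
    using F0[of t] u by (intro mult_mono) auto
  then show "t powr (-\<theta>) * F t \<le> 2 * (u powr (-\<theta>) * F u)" by (simp add: mult_ac)
  have "2 powr (-\<theta>) * u powr (-\<theta>) = (2 * u) powr (-\<theta>)" using u by (simp add: powr_mult)
  also have "\<dots> \<le> t powr (-\<theta>)" using u \<theta> by (intro powr_mono2') auto
  finally have "2 powr (-\<theta>) * u powr (-\<theta>) * F u \<le> t powr (-\<theta>) * F t"
    using F0[OF u(1)] mono[OF u(1,2)] by (intro mult_mono) auto
  then show "2 powr (-\<theta>) * (u powr (-\<theta>) * F u) \<le> t powr (-\<theta>) * F t" by (simp add: mult_ac)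
qed

text \<open>The integrand is squeezed between two constant multiples of one dyadic step function,
  whose integral is the sum on the right.\<close>

lemma integral_finite_iff_dyadic:
  fixes F :: "real \<Rightarrow> real"
  assumes F0: "\<And>t. 0 < t \<Longrightarrow> 0 \<le> F t"
    and mono: "\<And>u t. 0 < u \<Longrightarrow> u \<le> t \<Longrightarrow> F u \<le> F t"
    and quasiconcave: "\<And>u t. 0 < u \<Longrightarrow> u \<le> t \<Longrightarrow> u * F t \<le> t * F u"
    and \<theta>: "0 < \<theta>" and s: "0 < s"
  shows "(\<integral>\<^sup>+t\<in>{0<..}. ennreal ((t powr (-\<theta>) * F t) powr s / t) \<partial>lborel) < \<infinity> \<longleftrightarrow>
    (\<integral>\<^sup>+k. ennreal ((2 powr (-\<theta> * real_of_int k) * F (2 powr k)) powr s) \<partial>count_space UNIV) < \<infinity>"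
    (is "?I < \<infinity> \<longleftrightarrow> ?S < \<infinity>")
proof -
  define a where "a k = (2 powr (-\<theta> * real_of_int k) * F (2 powr k)) powr s" for k :: int
  define h where "h c t = (\<integral>\<^sup>+k. ennreal (c * a k / 2 powr k) * indicator {2 powr k..<2 * 2 powr k} t \<partial>count_space UNIV)"
    for c t :: real
  define g where "g t = ennreal ((t powr (-\<theta>) * F t) powr s / t) * indicator {0<..} t" for t
  have a0: "0 \<le> a k" for k by (simp add: a_def)
  have int_h: "(\<integral>\<^sup>+t. h c t \<partial>lborel) = ennreal c * ?S" if "0 \<le> c" for c
  proof -
    have "(\<integral>\<^sup>+t. h c t \<partial>lborel) = (\<integral>\<^sup>+k. ennreal (c * a k) \<partial>count_space UNIV)"
      unfolding h_def using a0 that by (intro nn_integral_dyadic_step) simp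
    also have "\<dots> = ennreal c * ?S"
      using a0 that by (simp add: ennreal_mult nn_integral_cmult a_def)
    finally show ?thesis .
  qed
  \<comment> \<open>The extra \<open>1/2\<close> in the lower constant comes from
    \<open>1 / t\<close>, which may drop to half of \<open>1 / 2 powr m\<close> inside the
    octave.\<close>
  have bounds: "g t \<le> h (2 powr s) t" "h (2 powr (-\<theta> * s) / 2) t \<le> g t" for t
  proof -
    show "g t \<le> h (2 powr s) t"
    proof (cases "0 < t")
      case True
      define m where "m = \<lfloor>log 2 t\<rfloor>"
      note m = dyadic_step_eval(2,3)[OF True, folded m_def]
      have h: "h c t = ennreal (c * a m / 2 powr m)" for c
        unfolding h_def m_def using True by (rule dyadic_step_eval(1))
      have "(t powr (-\<theta>) * F t) powr s \<le> (2 * ((2 powr m) powr (-\<theta>) * F (2 powr m))) powr s"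
        using m s True F0[OF True]
        by (intro powr_mono2 dyadic_comparison(1)[OF F0 mono quasiconcave \<theta>]) auto
      also have "\<dots> = 2 powr s * a m"
        using F0[of "2 powr m"] by (simp add: a_def powr_mult powr_powr mult.commute)
      finally have "(t powr (-\<theta>) * F t) powr s / t \<le> 2 powr s * a m / 2 powr m"
        using m(1) True a0[of m] by (intro frac_le) auto
      then show ?thesis using True by (simp add: g_def h ennreal_leI)
    qed (simp add: g_def)
    show "h (2 powr (-\<theta> * s) / 2) t \<le> g t"
    proof (cases "0 < t")
      case True
      define m where "m = \<lfloor>log 2 t\<rfloor>"
      note m = dyadic_step_eval(2,3)[OF True, folded m_def]
      have h: "h c t = ennreal (c * a m / 2 powr m)" for c
        unfolding h_def m_def using True by (rule dyadic_step_eval(1))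
      have "2 powr (-\<theta> * s) * a m = (2 powr (-\<theta>) * ((2 powr m) powr (-\<theta>) * F (2 powr m))) powr s"
        using F0[of "2 powr m"] by (simp add: a_def powr_mult powr_powr mult.commute)
      also have "\<dots> \<le> (t powr (-\<theta>) * F t) powr s"
        using m s True F0[of "2 powr m"]
        by (intro powr_mono2 dyadic_comparison(2)[OF F0 mono quasiconcave \<theta>]) auto
      finally have "2 powr (-\<theta> * s) * a m / (2 * 2 powr m) \<le> (t powr (-\<theta>) * F t) powr s / t"
        using m(2) True a0[of m] by (intro frac_le) auto
      then show ?thesis using True by (simp add: g_def h ennreal_leI)
    next
      case False
      then have "indicator {2 powr real_of_int k..<2 * 2 powr real_of_int k} t = (0::ennreal)" for k
        using powr_gt_zero[of 2 "real_of_int k"] by (auto simp: indicator_def)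
      then show ?thesis by (simp add: h_def)
    qed
  qed
  have I: "?I = (\<integral>\<^sup>+t. g t \<partial>lborel)" by (simp add: g_def)
  have up: "?I \<le> ennreal (2 powr s) * ?S"
    unfolding I by (subst int_h[symmetric]) (auto intro!: nn_integral_mono bounds)
  have lo: "ennreal (2 powr (-\<theta> * s) / 2) * ?S \<le> ?I"
    unfolding I by (subst int_h[symmetric]) (auto intro!: nn_integral_mono bounds[simplified])
  show ?thesis
  proof
    assume "?I < \<infinity>"
    then have "ennreal (2 powr (-\<theta> * s) / 2) * ?S < \<infinity>" using lo by (rule le_less_trans[rotated])
    \<comment> \<open>Positivity matters since \<open>0 * \<infinity> = 0\<close> in
      \<open>ennreal\<close>.\<close>
    moreover have "0 < ennreal (2 powr (-\<theta> * s) / 2)" by (subst ennreal_less_zero_iff) simp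
    ultimately show "?S < \<infinity>" by (auto simp: ennreal_mult_less_top)
  next
    assume "?S < \<infinity>"
    then have "ennreal (2 powr s) * ?S < \<infinity>" by (simp add: ennreal_mult_less_top)
    then show "?I < \<infinity>" using up by (rule le_less_trans[rotated])
  qed
qed

lemma SUP_finite_iff_dyadic:
  fixes F :: "real \<Rightarrow> real"
  assumes F0: "\<And>t. 0 < t \<Longrightarrow> 0 \<le> F t"
    and mono: "\<And>u t. 0 < u \<Longrightarrow> u \<le> t \<Longrightarrow> F u \<le> F t"
    and quasiconcave: "\<And>u t. 0 < u \<Longrightarrow> u \<le> t \<Longrightarrow> u * F t \<le> t * F u"
    and \<theta>: "0 < \<theta>"
  shows "(SUP t\<in>{0<..}. ennreal (t powr (-\<theta>) * F t)) < \<infinity> \<longleftrightarrow>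
    bdd_above (range (\<lambda>k::int. 2 powr (-\<theta> * real_of_int k) * F (2 powr k)))"
    (is "?S < \<infinity> \<longleftrightarrow> _")
proof
  assume fin: "?S < \<infinity>"
  have "2 powr (-\<theta> * real_of_int k) * F (2 powr k) \<le> enn2real ?S" for k :: int
  proof -
    have "ennreal ((2 powr k) powr (-\<theta>) * F (2 powr k)) \<le> ?S"
      by (intro SUP_upper) simp
    then have "(2 powr k) powr (-\<theta>) * F (2 powr k) \<le> enn2real ?S"
      using fin F0[of "2 powr k"] by (metis enn2real_ennreal enn2real_mono infinity_ennreal_def
        mult_nonneg_nonneg powr_ge_zero powr_gt_zero zero_neq_numeral)
    then show ?thesis by (simp add: powr_powr mult.commute)
  qed
  then show "bdd_above (range (\<lambda>k::int. 2 powr (-\<theta> * real_of_int k) * F (2 powr k)))"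
    by (auto simp: bdd_above_def)
next
  assume "bdd_above (range (\<lambda>k::int. 2 powr (-\<theta> * real_of_int k) * F (2 powr k)))"
  then obtain M where M: "\<And>k::int. 2 powr (-\<theta> * real_of_int k) * F (2 powr k) \<le> M"
    by (auto simp: bdd_above_def)
  have "t powr (-\<theta>) * F t \<le> 2 * M" if t: "0 < t" for t
  proof -
    define m where "m = \<lfloor>log 2 t\<rfloor>"
    note m = dyadic_step_eval(2,3)[OF t, folded m_def]
    have "t powr (-\<theta>) * F t \<le> 2 * ((2 powr m) powr (-\<theta>) * F (2 powr m))"
      using m by (intro dyadic_comparison(1)[OF F0 mono quasiconcave \<theta>]) auto
    then show ?thesis using M[of m] by (simp add: powr_powr mult.commute)
  qed
  then have "?S \<le> ennreal (2 * M)"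
    by (intro SUP_least ennreal_leI) auto
  then show "?S < \<infinity>" by (rule le_less_trans) simp
qed

subsection \<open>The K-functional of a quasi-normed couple\<close>

text \<open>The constant is a parameter so that the two spaces of a couple can share it.\<close>

locale quasi_normed =
  fixes A :: "'v::real_vector set" and n :: "'v \<Rightarrow> real" and C :: real
  assumes subspace: "subspace A"
    and nonneg: "x \<in> A \<Longrightarrow> 0 \<le> n x"
    and scale: "x \<in> A \<Longrightarrow> n (r *\<^sub>R x) = \<bar>r\<bar> * n x"
    and triangle: "x \<in> A \<Longrightarrow> y \<in> A \<Longrightarrow> n (x + y) \<le> C * (n x + n y)"
    and C_ge_1: "1 \<le> C"
begin

lemma zero: "n 0 = 0"
  using scale[of 0 0] subspace_0[OF subspace] by simp

lemma minus: "x \<in> A \<Longrightarrow> n (- x) = n x"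
  using scale[of x "-1"] by simp

lemma triangle_diff: "x \<in> A \<Longrightarrow> y \<in> A \<Longrightarrow> n (x - y) \<le> C * (n x + n y)"
  using triangle[of x "- y"] minus[of y] subspace_neg[OF subspace] by simp

lemma sum_mem: "(\<And>i. u i \<in> A) \<Longrightarrow> sum u I \<in> A"
  by (rule subspace_sum[OF subspace])

text \<open>Every use of the quasi-triangle inequality costs a factor \<open>C\<close>, so a naive
  bound of a long sum degenerates with its length. Weights growing by a factor of at least
  \<open>2 * C\<close> pay for this: the last term dominates, and splitting it off keeps the
  constant fixed.\<close>

lemma sum_le_increasing:
  assumes u: "\<And>i. u i \<in> A" "\<And>i. n (u i) \<le> B * w i"
    and w: "\<And>i. 0 \<le> w i" "\<And>i. w i \<le> \<kappa> * w (Suc i)" and \<kappa>: "2 * C * \<kappa> \<le> 1" and B: "0 \<le> B"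
  shows "n (sum u {..m}) \<le> 2 * C * B * w m"
proof (induction m)
  case 0
  have "B * w 0 \<le> 2 * C * (B * w 0)"
    using mult_right_mono[of 1 "2 * C" "B * w 0"] C_ge_1 B w(1)[of 0] by simp
  then show ?case using u(2)[of 0] by simp
next
  case (Suc m)
  have "n (sum u {..Suc m}) \<le> C * (n (sum u {..m}) + n (u (Suc m)))"
    using triangle[of "sum u {..m}" "u (Suc m)"] u(1) by (simp add: sum_mem)
  also have "\<dots> \<le> C * (2 * C * B * (\<kappa> * w (Suc m)) + B * w (Suc m))"
  proof -
    have "2 * C * B * w m \<le> 2 * C * B * (\<kappa> * w (Suc m))"
      using C_ge_1 B w(2)[of m] by (intro mult_left_mono) auto
    with Suc have "n (sum u {..m}) \<le> 2 * C * B * (\<kappa> * w (Suc m))" by (rule order_trans)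
    then show ?thesis using C_ge_1 by (intro mult_left_mono add_mono u(2)) auto
  qed
  also have "\<dots> = (2 * C * \<kappa>) * (C * B * w (Suc m)) + C * B * w (Suc m)"
    by (simp add: algebra_simps)
  also have "\<dots> \<le> 1 * (C * B * w (Suc m)) + C * B * w (Suc m)"
    using \<kappa> C_ge_1 B w(1)[of "Suc m"] by (intro add_right_mono mult_right_mono) auto
  finally show ?case by (simp add: mult_ac)
qed

text \<open>Mirror image of the increasing case: the first term dominates and is split off, hence an
  induction that varies the starting point \<open>m\<close>.\<close>

lemma sum_le_decreasing:
  assumes u: "\<And>i. u i \<in> A" "\<And>i. n (u i) \<le> B * w i"
    and w: "\<And>i. 0 \<le> w i" "\<And>i. w (Suc i) \<le> \<kappa> * w i" and \<kappa>: "2 * C * \<kappa> \<le> 1" and B: "0 \<le> B"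
  shows "n (sum u {m..<m + j}) \<le> 2 * C * B * w m"
proof (induction j arbitrary: m)
  case 0
  then show ?case using zero C_ge_1 B w(1)[of m] by simp
next
  case (Suc j)
  have eq: "sum u {m..<m + Suc j} = u m + sum u {Suc m..<Suc m + j}"
    by (simp add: sum.atLeast_Suc_lessThan)
  have "n (sum u {m..<m + Suc j}) \<le> C * (n (u m) + n (sum u {Suc m..<Suc m + j}))"
    unfolding eq using u(1) by (intro triangle sum_mem)
  also have "\<dots> \<le> C * (B * w m + 2 * C * B * (\<kappa> * w m))"
  proof -
    have "2 * C * B * w (Suc m) \<le> 2 * C * B * (\<kappa> * w m)"
      using C_ge_1 B w(2)[of m] by (intro mult_left_mono) auto
    with Suc have "n (sum u {Suc m..<Suc m + j}) \<le> 2 * C * B * (\<kappa> * w m)" by (rule order_trans)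
    then show ?thesis using C_ge_1 by (intro mult_left_mono add_mono u(2)) auto
  qed
  also have "\<dots> = (2 * C * \<kappa>) * (C * B * w m) + C * B * w m"
    by (simp add: algebra_simps)
  also have "\<dots> \<le> 1 * (C * B * w m) + C * B * w m"
    using \<kappa> C_ge_1 B w(1)[of m] by (intro add_right_mono mult_right_mono) auto
  finally show ?case by (simp add: mult_ac)
qed

text \<open>The weights decay geometrically, which makes the partial sums Cauchy; the limit inherits
  the tail bound up to one more factor \<open>C\<close>.\<close>

lemma series_limit:
  assumes complete: "quasi_Banach A n"
    and u: "\<And>i. u i \<in> A" "\<And>i. n (u i) \<le> B * w i"
    and w: "\<And>i. 0 \<le> w i" "\<And>i. w (Suc i) \<le> \<kappa> * w i" and \<kappa>: "2 * C * \<kappa> \<le> 1" and B: "0 \<le> B"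
  obtains y where "y \<in> A" "\<And>m. n (y - sum u {..<m}) \<le> 2 * C\<^sup>2 * B * w m"
proof -
  define U where "U m = sum u {..<m}" for m
  have UA: "U m \<in> A" for m unfolding U_def using u(1) by (rule sum_mem)
  have diff: "n (U i - U m) \<le> 2 * C * B * w m" if "m \<le> i" for i m
  proof -
    have "U i - U m = sum u {m..<m + (i - m)}"
      using that by (simp add: U_def sum_diff_nat_ivl[of 0 m i, simplified] flip: atLeast0LessThan)
    then show ?thesis using sum_le_decreasing[of u B w \<kappa> m "i - m", OF u w \<kappa> B] by simp
  qed
  have half: "w (Suc i) \<le> w i / 2" for i
  proof -
    have "2 * \<kappa> \<le> 1"
      using \<kappa> C_ge_1 mult_right_mono[of 1 C "2 * \<kappa>"] by (cases "0 \<le> \<kappa>") auto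
    then have "2 * \<kappa> * w i \<le> 1 * w i" using w(1)[of i] by (intro mult_right_mono) auto
    then show ?thesis using w(2)[of i] by simp
  qed
  have anti: "decseq w" using half w(1) by (intro decseq_SucI) (smt (verit) field_sum_of_halves)
  have "w i \<le> w 0 * (1/2) ^ i" for i
  proof (induction i)
    case (Suc i)
    then show ?case using half[of i] by simp
  qed simp
  moreover have "(\<lambda>i. w 0 * (1/2) ^ i) \<longlonglongrightarrow> w 0 * 0"
    by (intro tendsto_mult tendsto_const LIMSEQ_power_zero) simp
  ultimately have w0: "w \<longlonglongrightarrow> 0"
    using w(1) by (intro tendsto_sandwich[of "\<lambda>_. 0" w _ "\<lambda>i. w 0 * (1/2) ^ i"]) auto
  have "\<exists>N. \<forall>i\<ge>N. \<forall>j\<ge>N. n (U i - U j) < e" if e: "0 < e" for e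
  proof -
    have "(\<lambda>i. 2 * C * B * w i) \<longlonglongrightarrow> 2 * C * B * 0"
      by (intro tendsto_mult tendsto_const w0)
    then have "eventually (\<lambda>i. 2 * C * B * w i < e) sequentially"
      using e by (intro order_tendstoD) auto
    then obtain N where N: "2 * C * B * w N < e" by (auto simp: eventually_sequentially)
    have "n (U i - U j) < e" if ij: "N \<le> i" "N \<le> j" for i j
    proof -
      have bound: "2 * C * B * w m < e" if "N \<le> m" for m
      proof -
        have "2 * C * B * w m \<le> 2 * C * B * w N"
          using decseqD[OF anti that] C_ge_1 B by (intro mult_left_mono) auto
        then show ?thesis using N by simp
      qed
      show ?thesis
      proof (cases "j \<le> i")
        case True
        then show ?thesis using diff[OF True] bound[OF ij(2)] by simp
      next
        case False
        moreover have "n (U i - U j) = n (U j - U i)"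
          using minus[of "U j - U i"] UA subspace_diff[OF subspace] by simp
        ultimately show ?thesis using diff[of i j] bound[OF ij(1)] by simp
      qed
    qed
    then show ?thesis by blast
  qed
  then obtain y where y: "y \<in> A" "(\<lambda>k. n (U k - y)) \<longlonglongrightarrow> 0"
    using complete UA unfolding quasi_Banach_def by blast
  have "n (y - U m) \<le> 2 * C\<^sup>2 * B * w m" for m
  proof -
    \<comment> \<open>A quasi-norm may be discontinuous, so the bound for \<open>U k - U m\<close>
      cannot simply be passed to the limit. The detour through \<open>U k\<close> costs the second
      factor \<open>C\<close>.\<close>
    have le: "n (y - U m) \<le> C * (n (U k - y) + 2 * C * B * w m)" if k: "m \<le> k" for k
    proof -
      have "n (y - U m) = n ((U k - U m) - (U k - y))" by simp
      also have "\<dots> \<le> C * (n (U k - U m) + n (U k - y))"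
        using UA y(1) by (intro triangle_diff subspace_diff[OF subspace])
      also have "\<dots> \<le> C * (n (U k - y) + 2 * C * B * w m)"
        using diff[OF k] C_ge_1 by (intro mult_left_mono) auto
      finally show ?thesis .
    qed
    have "(\<lambda>k. C * (n (U k - y) + 2 * C * B * w m)) \<longlonglongrightarrow> C * (0 + 2 * C * B * w m)"
      by (intro tendsto_mult tendsto_add tendsto_const y(2))
    then have "n (y - U m) \<le> C * (0 + 2 * C * B * w m)"
      using le by (intro LIMSEQ_le_const) auto
    then show ?thesis by (simp add: power2_eq_square mult_ac)
  qed
  then show ?thesis using that y(1) by (auto simp: U_def)
qed

end

section \<open>Elementary properties of the K-functional\<close>

locale quasi_couple =
  X0: quasi_normed A0 n0 C + X1: quasi_normed A1 n1 C
  for A0 A1 :: "'v::real_vector set" and n0 n1 :: "'v \<Rightarrow> real" and C :: real +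
  assumes complete0: "quasi_Banach A0 n0" and complete1: "quasi_Banach A1 n1"
begin

abbreviation K :: "'v \<Rightarrow> real \<Rightarrow> real" where "K \<equiv> K_functional A0 n0 A1 n1"

lemma K_le:
  assumes "a0 \<in> A0" "a1 \<in> A1" "0 < t"
  shows "K (a0 + a1) t \<le> n0 a0 + t * n1 a1"
  unfolding K_functional_def
  using assms X0.nonneg X1.nonneg
  by (intro cInf_lower bdd_belowI[of _ 0]) auto

text \<open>Membership in \<open>A0 + A1\<close> keeps the set of decompositions nonempty, as a
  lower bound for a real infimum requires.\<close>

lemma K_greatest:
  assumes "x \<in> A0 + A1" "\<And>a0 a1. a0 \<in> A0 \<Longrightarrow> a1 \<in> A1 \<Longrightarrow> x = a0 + a1 \<Longrightarrow> M \<le> n0 a0 + t * n1 a1"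
  shows "M \<le> K x t"
  unfolding K_functional_def
  using assms by (intro cInf_greatest) (auto simp: set_plus_def)

lemma K_nonneg: "x \<in> A0 + A1 \<Longrightarrow> 0 < t \<Longrightarrow> 0 \<le> K x t"
  using X0.nonneg X1.nonneg by (intro K_greatest) auto

lemma K_near:
  assumes "x \<in> A0 + A1" "K x t < e"
  obtains a0 a1 where "a0 \<in> A0" "a1 \<in> A1" "x = a0 + a1" "n0 a0 + t * n1 a1 < e"
  using K_greatest[OF assms(1), of e t] assms(2) by (meson linorder_not_le)

lemma K_mono:
  assumes x: "x \<in> A0 + A1" and "0 < u" "u \<le> t"
  shows "K x u \<le> K x t"
proof (rule K_greatest[OF x])
  fix a0 a1 assume a: "a0 \<in> A0" "a1 \<in> A1" "x = a0 + a1"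
  have "u * n1 a1 \<le> t * n1 a1" using assms X1.nonneg[OF a(2)] by (intro mult_right_mono)
  then show "K x u \<le> n0 a0 + t * n1 a1" using K_le[OF a(1,2), of u] a(3) assms by simp
qed

text \<open>A decomposition at time \<open>u\<close> is also one at time \<open>t\<close>; the
  factor \<open>u / t \<le> 1\<close> restores the weight of the \<open>A1\<close> part and can only
  shrink the \<open>A0\<close> part.\<close>

lemma K_quasiconcave:
  assumes x: "x \<in> A0 + A1" and u: "0 < u" "u \<le> t"
  shows "u * K x t \<le> t * K x u"
proof -
  have "u / t * K x t \<le> K x u"
  proof (rule K_greatest[OF x])
    fix a0 a1 assume a: "a0 \<in> A0" "a1 \<in> A1" "x = a0 + a1"
    have "u / t * K x t \<le> u / t * (n0 a0 + t * n1 a1)"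
      using K_le[OF a(1,2), of t] a(3) u by (intro mult_left_mono) auto
    also have "\<dots> = u / t * n0 a0 + u * n1 a1" using u by (simp add: field_simps)
    also have "\<dots> \<le> 1 * n0 a0 + u * n1 a1"
      using u X0.nonneg[OF a(1)] by (intro add_right_mono mult_right_mono) auto
    finally show "u / t * K x t \<le> n0 a0 + u * n1 a1" by simp
  qed
  then show ?thesis using u by (simp add: field_simps)
qed

lemma K_add:
  assumes x: "x \<in> A0 + A1" and y: "y \<in> A0 + A1" and t: "0 < t"
  shows "K (x + y) t \<le> C * (K x t + K y t)"
proof (rule field_le_epsilon)
  fix e :: real assume e: "0 < e"
  \<comment> \<open>Two decompositions, each off by \<open>d\<close>, enter with the factor
    \<open>C\<close>, so the total error is \<open>e\<close>.\<close>
  define d where "d = e / (2 * C)"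
  have C: "1 \<le> C" by (rule X0.C_ge_1)
  have d: "0 < d" using e C by (simp add: d_def)
  obtain a0 a1 where a: "a0 \<in> A0" "a1 \<in> A1" "x = a0 + a1" "n0 a0 + t * n1 a1 < K x t + d"
    using K_near[OF x, of t "K x t + d"] d by auto
  obtain b0 b1 where b: "b0 \<in> A0" "b1 \<in> A1" "y = b0 + b1" "n0 b0 + t * n1 b1 < K y t + d"
    using K_near[OF y, of t "K y t + d"] d by auto
  have "K (x + y) t = K ((a0 + b0) + (a1 + b1)) t" using a b by (simp add: algebra_simps)
  also have "\<dots> \<le> n0 (a0 + b0) + t * n1 (a1 + b1)"
    using a b t X0.subspace X1.subspace by (intro K_le) (auto intro: subspace_add)
  also have "\<dots> \<le> C * (n0 a0 + n0 b0) + t * (C * (n1 a1 + n1 b1))"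
    using X0.triangle[OF a(1) b(1)] X1.triangle[OF a(2) b(2)] t
    by (intro add_mono mult_left_mono) auto
  also have "\<dots> = C * ((n0 a0 + t * n1 a1) + (n0 b0 + t * n1 b1))" by (simp add: algebra_simps)
  also have "\<dots> \<le> C * ((K x t + d) + (K y t + d))"
    using a b C by (intro mult_left_mono) auto
  also have "\<dots> = C * (K x t + K y t) + e" using C by (simp add: d_def field_simps)
  finally show "K (x + y) t \<le> C * (K x t + K y t) + e" .
qed

lemma K_scale_le:
  assumes x: "x \<in> A0 + A1" and r: "0 < r" and t: "0 < t"
  shows "K (r *\<^sub>R x) t \<le> r * K x t"
proof -
  have "K (r *\<^sub>R x) t / r \<le> K x t"
  proof (rule K_greatest[OF x])
    fix a0 a1 assume a: "a0 \<in> A0" "a1 \<in> A1" "x = a0 + a1"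
    have "K (r *\<^sub>R x) t \<le> n0 (r *\<^sub>R a0) + t * n1 (r *\<^sub>R a1)"
      unfolding a(3) scaleR_add_right
      using a t X0.subspace X1.subspace by (intro K_le) (auto intro: subspace_scale)
    also have "\<dots> = r * (n0 a0 + t * n1 a1)"
      using X0.scale[OF a(1)] X1.scale[OF a(2)] r by (simp add: algebra_simps)
    finally show "K (r *\<^sub>R x) t / r \<le> n0 a0 + t * n1 a1" using r by (simp add: field_simps)
  qed
  then show ?thesis using r by (simp add: field_simps)
qed

lemma sum_space_scale: "x \<in> A0 + A1 \<Longrightarrow> r *\<^sub>R x \<in> A0 + A1"
  using X0.subspace X1.subspace unfolding set_plus_def
  by (fastforce simp: scaleR_add_right intro: subspace_scale)

lemma sum_space0: "a \<in> A0 \<Longrightarrow> a \<in> A0 + A1"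
  using subspace_0[OF X1.subspace] unfolding set_plus_def by force

lemma sum_space1: "a \<in> A1 \<Longrightarrow> a \<in> A0 + A1"
  using subspace_0[OF X0.subspace] unfolding set_plus_def by force

text \<open>The missing inequality is \<open>K_scale_le\<close> for the scaled vector and the factor
  \<open>inverse r\<close>.\<close>

lemma K_scale:
  assumes x: "x \<in> A0 + A1" and r: "0 < r" and t: "0 < t"
  shows "K (r *\<^sub>R x) t = r * K x t"
proof (rule antisym)
  have "K (inverse r *\<^sub>R (r *\<^sub>R x)) t \<le> inverse r * K (r *\<^sub>R x) t"
    using x r t by (intro K_scale_le sum_space_scale) auto
  then show "r * K x t \<le> K (r *\<^sub>R x) t" using r by (simp add: field_simps)
qed (use assms in \<open>rule K_scale_le\<close>)

end

subsection \<open>Blocks at peaks\<close>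

definition dyadic_K ::
  "'v::real_vector set \<Rightarrow> ('v \<Rightarrow> real) \<Rightarrow> 'v set \<Rightarrow> ('v \<Rightarrow> real) \<Rightarrow> real \<Rightarrow> 'v \<Rightarrow> int \<Rightarrow> real" where
  "dyadic_K A0 n0 A1 n1 \<theta> x k =
     2 powr (- \<theta> * real_of_int k) * K_functional A0 n0 A1 n1 x (2 powr real_of_int k)"

lemma ennreal_powr_finite_iff: "ennreal_powr u s < top \<longleftrightarrow> u < top"
  by (simp add: ennreal_powr_def top.not_eq_extremum)

context quasi_couple
begin

abbreviation f :: "real \<Rightarrow> 'v \<Rightarrow> int \<Rightarrow> real" where "f \<equiv> dyadic_K A0 n0 A1 n1"

lemma interp_space_iff:
  assumes \<theta>: "0 < \<theta>" and r: "0 < r"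
  shows "x \<in> interp_space A0 n0 A1 n1 \<theta> r \<longleftrightarrow> x \<in> A0 + A1 \<and> mem_ell r (f \<theta> x) UNIV"
proof (cases "x \<in> A0 + A1")
  case x: True
  note K = K_nonneg[OF x] K_mono[OF x] K_quasiconcave[OF x]
  show ?thesis
  proof (cases "r = \<infinity>")
    case True
    then show ?thesis
      using x SUP_finite_iff_dyadic[of "K x" \<theta>, OF K \<theta>]
      by (simp add: interp_space_def interp_quasi_norm_def mem_ell_def dyadic_K_def)
  next
    case False
    then have s: "0 < enn2real r"
      using r by (simp add: enn2real_positive_iff top.not_eq_extremum)
    show ?thesis
      using x False integral_finite_iff_dyadic[of "K x" \<theta> "enn2real r", OF K \<theta> s]
      by (simp add: interp_space_def interp_quasi_norm_def mem_ell_def dyadic_K_def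
          ennreal_powr_finite_iff)
  qed
qed (simp add: interp_space_def)

lemma K_eq_f: "K x (2 powr real_of_int k) = 2 powr (\<theta> * real_of_int k) * f \<theta> x k"
  by (simp add: dyadic_K_def flip: mult.assoc powr_add)

lemma f_nonneg: "x \<in> A0 + A1 \<Longrightarrow> 0 \<le> f \<theta> x k"
  using K_nonneg[of x "2 powr k"] by (simp add: dyadic_K_def)

text \<open>Monotonicity and quasiconcavity bound \<open>K x t\<close> below by a positive multiple
  of \<open>K x s\<close> for any two times, so \<open>f\<close> vanishes nowhere or
  everywhere.\<close>

lemma f_pos:
  assumes x: "x \<in> A0 + A1" and k: "f \<theta> x k \<noteq> 0"
  shows "0 < f \<theta> x j"
proof -
  define s t where "s = (2::real) powr k" and "t = (2::real) powr j"
  have st: "0 < s" "0 < t" by (auto simp: s_def t_def)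
  have "K x s > 0" using k K_nonneg[OF x st(1)] by (simp add: dyadic_K_def s_def)
  moreover have "s * K x t \<ge> min s t * K x s"
  proof (cases "s \<le> t")
    case True
    then show ?thesis using K_mono[OF x st(1) True] st by simp
  next
    case False
    then show ?thesis using K_quasiconcave[OF x st(2), of s] by simp
  qed
  moreover have "0 < min s t * K x s" using st calculation(1) by simp
  ultimately have "0 < s * K x t" by linarith
  then have "0 < K x t" using st by (simp add: zero_less_mult_iff)
  then show ?thesis by (simp add: dyadic_K_def t_def)
qed

text \<open>The blocks are normalised: the size of the peak they were cut from is divided out.\<close>

definition block_at :: "real \<Rightarrow> real \<Rightarrow> real \<Rightarrow> int \<Rightarrow> 'v \<Rightarrow> bool" where
  "block_at \<theta> B c p b \<longleftrightarrow> b \<in> A0 \<and> b \<in> A1 \<and>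
     n0 b \<le> B * 2 powr (\<theta> * p) \<and> n1 b \<le> B * 2 powr (- (1 - \<theta>) * p) \<and>
     c * 2 powr (\<theta> * p) \<le> K b (2 powr p)"

text \<open>The peak condition limits the growth of \<open>f\<close> away from \<open>p\<close> to
  rate \<open>\<eta>\<close>, so what \<open>x\<close> has below scale \<open>s\<close> and above
  scale \<open>t\<close> is negligible at time \<open>2 powr p\<close>. The constants depend on
  \<open>L\<close>, \<open>C\<close> and \<open>\<eta>\<close> but not on \<open>p\<close>, which
  later allows blocks from infinitely many peaks to be summed.\<close>

lemma block_at_peak:
  assumes x: "x \<in> A0 + A1" and \<theta>: "0 < \<theta>" "\<theta> < 1" and pos: "\<And>k. 0 < f \<theta> x k"
    and \<eta>_def: "\<eta> = min \<theta> (1 - \<theta>) / 2"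
  obtains B c where "0 < B" "0 < c" "\<And>p. peak \<eta> (f \<theta> x) p \<Longrightarrow> \<exists>b. block_at \<theta> B c p b"
proof -
  have C: "1 \<le> C" by (rule X0.C_ge_1)
  have \<eta>: "0 < \<eta>" using \<theta> by (simp add: \<eta>_def)
  \<comment> \<open>\<open>L\<close> is so large that the remainder \<open>x - d\<close>, of size at
    most \<open>4 * 2 powr (- \<eta> * L)\<close> relative to the peak, stays below
    \<open>c\<close>.\<close>
  obtain L :: nat where L: "log 2 (8 * C) / \<eta> \<le> real L" using real_arch_simple by blast
  have "log 2 (8 * C) \<le> \<eta> * L" using L \<eta> by (simp add: field_simps)
  then have L8: "8 * C \<le> 2 powr (\<eta> * L)" using C by (subst (asm) log_le_iff) auto
  define B where "B = 4 * C * 2 powr ((1 + \<eta>) * L)"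
  define c where "c = 1 / (2 * C)"
  have "\<exists>b. block_at \<theta> B c p b" if peak: "peak \<eta> (f \<theta> x) p" for p
  proof -
    define F where "F = f \<theta> x p"
    define T where "T = (2::real) powr p"
    define s t where "s = (2::real) powr (p - int L)" and "t = (2::real) powr (p + int L)"
    have st: "0 < s" "0 < t" "s \<le> t" "0 < T" by (auto simp: s_def t_def T_def)
    have F: "0 < F" using pos by (simp add: F_def)
    have near: "f \<theta> x j \<le> F * 2 powr (\<eta> * \<bar>real_of_int (j - p)\<bar>)" for j
      using peak by (simp add: peak_def F_def powr_minus field_simps)
    have Ks: "K x s \<le> F * 2 powr (\<theta> * p) * 2 powr ((\<eta> - \<theta>) * L)"
    proof -
      have "K x s \<le> 2 powr (\<theta> * (p - int L)) * (F * 2 powr (\<eta> * L))"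
        unfolding s_def K_eq_f[of x _ \<theta>] using near[of "p - int L"] by (intro mult_left_mono) auto
      also have "\<dots> = F * 2 powr (\<theta> * p) * 2 powr ((\<eta> - \<theta>) * L)"
        by (simp add: algebra_simps flip: powr_add)
      finally show ?thesis .
    qed
    have Kt: "K x t \<le> F * 2 powr (\<theta> * p) * 2 powr ((\<eta> + \<theta>) * L)"
    proof -
      have "K x t \<le> 2 powr (\<theta> * (p + int L)) * (F * 2 powr (\<eta> * L))"
        unfolding t_def K_eq_f[of x _ \<theta>] using near[of "p + int L"] by (intro mult_left_mono) auto
      also have "\<dots> = F * 2 powr (\<theta> * p) * 2 powr ((\<eta> + \<theta>) * L)"
        by (simp add: algebra_simps flip: powr_add)
      finally show ?thesis .
    qed
    have Kpos: "0 < K x s" "0 < K x t"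
      unfolding s_def t_def K_eq_f[of x _ \<theta>] using pos by auto
    \<comment> \<open>Twice the infimum is a strict upper bound because \<open>K x s\<close> and
      \<open>K x t\<close> are positive.\<close>
    obtain a0 a1 where a: "a0 \<in> A0" "a1 \<in> A1" "x = a0 + a1" "n0 a0 + s * n1 a1 < 2 * K x s"
      using K_near[OF x, of s "2 * K x s"] Kpos by auto
    obtain a0' a1' where a': "a0' \<in> A0" "a1' \<in> A1" "x = a0' + a1'" "n0 a0' + t * n1 a1' < 2 * K x t"
      using K_near[OF x, of t "2 * K x t"] Kpos by auto
    have nn: "0 \<le> n0 a0" "0 \<le> n1 a1" "0 \<le> n0 a0'" "0 \<le> n1 a1'"
      using a a' X0.nonneg X1.nonneg by auto
    have na0: "n0 a0 \<le> 2 * K x s" and na0': "n0 a0' \<le> 2 * K x t"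
    proof -
      have "0 \<le> s * n1 a1" "0 \<le> t * n1 a1'" using nn st by auto
      then show "n0 a0 \<le> 2 * K x s" "n0 a0' \<le> 2 * K x t" using a(4) a'(4) by linarith+
    qed
    have "s * n1 a1 \<le> 2 * K x s" "t * n1 a1' \<le> 2 * K x t" using a(4) a'(4) nn by auto
    then have na1: "n1 a1 \<le> 2 * K x s / s" and na1': "n1 a1' \<le> 2 * K x t / t"
      using st by (auto simp: field_simps)
    \<comment> \<open>The part of \<open>x\<close> living at scales between \<open>s\<close> and \<open>t\<close>; also equal to \<open>a1 - a1'\<close>, hence in \<open>A0 \<inter> A1\<close>.\<close>
    define d where "d = a0' - a0"
    have d1: "d = a1 - a1'" using a(3) a'(3) by (simp add: d_def algebra_simps)
    have dA: "d \<in> A0" "d \<in> A1"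
      using a a' X0.subspace X1.subspace by (auto simp: d_def intro: subspace_diff)
        (auto simp: d1[unfolded d_def] intro: subspace_diff)
    have "n0 d \<le> C * (n0 a0' + n0 a0)" unfolding d_def using a a' by (intro X0.triangle_diff)
    also have "\<dots> \<le> C * (2 * K x t + 2 * K x t)"
      using na0 na0' K_mono[OF x st(1,3)] C by (intro mult_left_mono add_mono) auto
    also have "\<dots> \<le> 4 * C * (F * 2 powr (\<theta> * p) * 2 powr ((\<eta> + \<theta>) * L))"
      using mult_left_mono[OF Kt, of "4 * C"] C by (simp add: mult_ac)
    also have "\<dots> \<le> 4 * C * (F * 2 powr (\<theta> * p) * 2 powr ((1 + \<eta>) * L))"
      using \<theta> F C by (intro mult_left_mono powr_mono mult_right_mono) auto
    finally have n0d: "n0 d \<le> F * (B * 2 powr (\<theta> * p))" by (simp add: B_def mult_ac)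
    have "n1 d \<le> C * (n1 a1 + n1 a1')" unfolding d1 using a a' by (intro X1.triangle_diff)
    also have "\<dots> \<le> C * (2 * (K x s / s) + 2 * (K x s / s))"
    proof -
      have "K x t / t \<le> K x s / s" using K_quasiconcave[OF x st(1,3)] st by (simp add: field_simps)
      then show ?thesis using na1 na1' C by (intro mult_left_mono add_mono) auto
    qed
    also have "\<dots> = 4 * C / s * K x s" by (simp add: field_simps)
    also have "\<dots> \<le> 4 * C / s * (F * 2 powr (\<theta> * p) * 2 powr ((\<eta> - \<theta>) * L))"
      using C st by (intro mult_left_mono Ks) auto
    also have "\<dots> = 4 * C * (F * 2 powr (- (1 - \<theta>) * p) * 2 powr ((1 + \<eta> - \<theta>) * L))"
    proof -
      have "2 powr (\<theta> * p) * 2 powr ((\<eta> - \<theta>) * L) / s = 2 powr (- (1 - \<theta>) * p) * 2 powr ((1 + \<eta> - \<theta>) * L)"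
        by (simp add: s_def algebra_simps flip: powr_add powr_diff)
      then show ?thesis using st by (simp add: field_simps)
    qed
    also have "\<dots> \<le> 4 * C * (F * 2 powr (- (1 - \<theta>) * p) * 2 powr ((1 + \<eta>) * L))"
      using \<theta> F C by (intro mult_left_mono powr_mono mult_right_mono) auto
    finally have n1d: "n1 d \<le> F * (B * 2 powr (- (1 - \<theta>) * p))" by (simp add: B_def mult_ac)
    have xd: "x - d = a0 + a1'" using a'(3) by (simp add: d_def algebra_simps)
    have "K (x - d) T \<le> n0 a0 + T * n1 a1'"
      unfolding xd using a a' st by (intro K_le) auto
    also have "\<dots> \<le> 2 * K x s + T * (2 * K x t / t)"
      using na0 na1' st by (intro add_mono mult_left_mono) auto
    also have "\<dots> = 2 * K x s + (2 * T / t) * K x t" by simp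
    also have "\<dots> \<le> 2 * (F * 2 powr (\<theta> * p) * 2 powr (- \<eta> * L)) + 2 * (F * 2 powr (\<theta> * p) * 2 powr (- \<eta> * L))"
    proof (rule add_mono)
      \<comment> \<open>Half the minimum in \<open>\<eta>\<close> gives
        \<open>\<eta> - \<theta> \<le> - \<eta>\<close> here and
        \<open>\<eta> + \<theta> - 1 \<le> - \<eta>\<close> for the other summand.\<close>
      have "2 powr ((\<eta> - \<theta>) * L) \<le> 2 powr (- \<eta> * L)"
        by (intro powr_mono mult_right_mono) (auto simp: \<eta>_def)
      then have "F * 2 powr (\<theta> * p) * 2 powr ((\<eta> - \<theta>) * L) \<le> F * 2 powr (\<theta> * p) * 2 powr (- \<eta> * L)"
        using F by (intro mult_left_mono) auto
      then show "2 * K x s \<le> 2 * (F * 2 powr (\<theta> * p) * 2 powr (- \<eta> * L))"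
        using Ks by linarith
      have "(2 * T / t) * K x t \<le> (2 * T / t) * (F * 2 powr (\<theta> * p) * 2 powr ((\<eta> + \<theta>) * L))"
        using st by (intro mult_left_mono Kt) auto
      also have "\<dots> = 2 * (F * 2 powr (\<theta> * p) * (T / t * 2 powr ((\<eta> + \<theta>) * L)))" by simp
      also have "T / t * 2 powr ((\<eta> + \<theta>) * L) = 2 powr ((\<eta> + \<theta> - 1) * L)"
        by (simp add: T_def t_def algebra_simps flip: powr_add powr_diff)
      also have "2 * (F * 2 powr (\<theta> * p) * 2 powr ((\<eta> + \<theta> - 1) * L)) \<le> 2 * (F * 2 powr (\<theta> * p) * 2 powr (- \<eta> * L))"
        using F by (intro mult_left_mono powr_mono mult_right_mono) (auto simp: \<eta>_def)
      finally show "(2 * T / t) * K x t \<le> 2 * (F * 2 powr (\<theta> * p) * 2 powr (- \<eta> * L))" .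
    qed
    also have "\<dots> = F * 2 powr (\<theta> * p) * (4 * 2 powr (- \<eta> * L))" by simp
    also have "\<dots> \<le> F * 2 powr (\<theta> * p) * c"
    proof -
      have "4 * 2 powr (- \<eta> * L) \<le> c"
        using L8 C by (simp add: c_def powr_minus field_simps)
      then show ?thesis using F by (intro mult_left_mono) auto
    qed
    finally have Kxd: "K (x - d) T \<le> F * 2 powr (\<theta> * p) * c" .
    have dS: "d \<in> A0 + A1" using dA by (intro sum_space0)
    have xdS: "x - d \<in> A0 + A1" using a(1) a'(2) unfolding xd by (rule set_plus_intro)
    \<comment> \<open>The remainder accounts for at most half of the peak value, so \<open>d\<close>
      carries the rest.\<close>
    have "F * 2 powr (\<theta> * p) = K (d + (x - d)) T"
      using K_eq_f[of x p \<theta>] by (simp add: T_def F_def mult.commute)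
    also have "\<dots> \<le> C * (K d T + K (x - d) T)" using dS xdS st by (intro K_add)
    also have "\<dots> \<le> C * (K d T + F * 2 powr (\<theta> * p) * c)" using Kxd C by (intro mult_left_mono) auto
    also have "\<dots> = C * K d T + F * 2 powr (\<theta> * p) / 2" using C by (simp add: c_def field_simps)
    finally have Kd: "F * (c * 2 powr (\<theta> * p)) \<le> K d T"
      using C by (simp add: c_def field_simps)
    have "block_at \<theta> B c p (inverse F *\<^sub>R d)"
      unfolding block_at_def
    proof (intro conjI)
      show "n0 (inverse F *\<^sub>R d) \<le> B * 2 powr (\<theta> * p)"
        unfolding X0.scale[OF dA(1)] using n0d F by (simp add: field_simps)
      show "n1 (inverse F *\<^sub>R d) \<le> B * 2 powr (- (1 - \<theta>) * p)"
        unfolding X1.scale[OF dA(2)] using n1d F by (simp add: field_simps)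
      show "c * 2 powr (\<theta> * p) \<le> K (inverse F *\<^sub>R d) (2 powr p)"
        unfolding T_def[symmetric] K_scale[OF dS positive_imp_inverse_positive[OF F] st(4)]
        using Kd F by (simp add: field_simps)
    qed (use dA X0.subspace X1.subspace in \<open>auto intro: subspace_scale\<close>)
    then show ?thesis by blast
  qed
  moreover have "0 < B" "0 < c" using C by (auto simp: B_def c_def)
  ultimately show ?thesis using that by blast
qed

subsection \<open>Sums of separated blocks\<close>

text \<open>The weights \<open>\<mu>\<close> may decay slowly, so the geometric behaviour has to
  come from the gaps between peaks: \<open>A0\<close> norms of the blocks grow and \<open>A1\<close>
  norms shrink geometrically. At any time the earlier blocks are then controlled in
  \<open>A0\<close> by the last of them, and the later ones in \<open>A1\<close> by the
  first.\<close>

lemma gliding_sum: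
  assumes \<theta>: "0 < \<theta>" "\<theta> < 1" and B: "0 < B" "0 < c"
    and P: "\<And>p. p \<in> P \<Longrightarrow> \<exists>b. block_at \<theta> B c p b" "\<And>m. \<exists>p\<in>P. m \<le> p"
    and \<mu>: "\<And>i. 0 < \<mu> i" "\<And>i. \<mu> (Suc i) \<le> \<mu> i" "\<And>i. \<mu> i \<le> Q * \<mu> (Suc i)"
  obtains y c' D \<delta> and p :: "nat \<Rightarrow> int"
  where "y \<in> A1" "0 < c'" "0 \<le> D" "0 < \<delta>" "inj p" "\<And>i. c' * \<mu> i \<le> f \<theta> y (p i)"
    "\<And>k. \<exists>i. f \<theta> y k \<le> D * (\<mu> i * 2 powr (- \<delta> * \<bar>real_of_int (k - p i)\<bar>))"
proof -
  have C: "1 \<le> C" by (rule X0.C_ge_1)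
  \<comment> \<open>A block decays at rate \<open>\<theta>\<close> to the right of its peak, by its
    \<open>A0\<close> norm, and at rate \<open>1 - \<theta>\<close> to the left, by its
    \<open>A1\<close> norm; \<open>\<delta>\<close> serves both sides.\<close>
  define \<delta> where "\<delta> = min \<theta> (1 - \<theta>)"
  have \<delta>: "0 < \<delta>" "\<delta> \<le> \<theta>" "\<delta> \<le> 1 - \<theta>" using \<theta> by (auto simp: \<delta>_def)
  \<comment> \<open>The first bound makes the estimates for geometric sums applicable; the second
    keeps the influence of all other blocks at a peak below half of the block there.\<close>
  define \<kappa> where "\<kappa> = min (1 / (2 * C)) (c / (8 * C ^ 3 * B))"
  have \<kappa>0: "0 < \<kappa>" using B C by (simp add: \<kappa>_def)
  have \<kappa>1: "2 * C * \<kappa> \<le> 1"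
  proof -
    have "\<kappa> \<le> 1 / (2 * C)" by (simp add: \<kappa>_def)
    then show ?thesis using C by (simp add: field_simps)
  qed
  have \<kappa>2: "8 * C ^ 3 * B * \<kappa> \<le> c"
  proof -
    have "\<kappa> \<le> c / (8 * C ^ 3 * B)" by (simp add: \<kappa>_def)
    then show ?thesis using B C by (simp add: field_simps)
  qed
  have Q: "1 \<le> Q"
  proof -
    have "1 * \<mu> 1 \<le> Q * \<mu> 1" using \<mu>(2)[of 0] \<mu>(3)[of 0] by simp
    then show ?thesis using \<mu>(1)[of 1] by (simp only: mult_le_cancel_right_pos)
  qed
  \<comment> \<open>A gap of \<open>N\<close> beats the ratio \<open>\<kappa>\<close> even after the
    loss \<open>Q\<close> from the change of weight.\<close>
  obtain N :: nat where N: "log 2 (Q / \<kappa>) / \<delta> \<le> real N" using real_arch_simple by blast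
  have "Q / \<kappa> \<le> 2 powr (\<delta> * N)"
  proof -
    have "log 2 (Q / \<kappa>) \<le> \<delta> * N" using N \<delta> by (simp add: field_simps)
    then show ?thesis using Q \<kappa>0 by (subst (asm) log_le_iff) auto
  qed
  then have gap: "Q * 2 powr (- \<delta> * N) \<le> \<kappa>"
    using \<kappa>0 by (simp add: powr_minus field_simps)
  \<comment> \<open>The additional \<open>1\<close> keeps the positions strictly increasing even if
    \<open>N = 0\<close>.\<close>
  have "\<exists>p. \<forall>i. p i \<in> P \<and> p i + int N + 1 \<le> p (Suc i)"
  proof (rule dependent_nat_choice)
    show "\<exists>p. p \<in> P" using P(2) by blast
  qed (use P(2) in blast)
  then obtain p where p: "\<And>i. p i \<in> P" "\<And>i. p i + int N + 1 \<le> p (Suc i)" by blast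
  have mono_p: "strict_mono p" using p(2) by (intro strict_mono_Suc_iff[THEN iffD2]) (smt (verit) of_nat_0_le_iff)
  have "\<forall>i. \<exists>b. block_at \<theta> B c (p i) b" using P(1) p(1) by blast
  then obtain b where b: "\<And>i. block_at \<theta> B c (p i) (b i)" by metis
  define u where "u i = \<mu> i *\<^sub>R b i" for i
  \<comment> \<open>Up to the factor \<open>B\<close>, \<open>w i\<close> and \<open>v i\<close>
    bound the \<open>A0\<close> and \<open>A1\<close> norms of \<open>u i\<close>; they balance at
    time \<open>2 powr p i\<close>.\<close>
  define w where "w i = \<mu> i * 2 powr (\<theta> * p i)" for i
  define v where "v i = \<mu> i * 2 powr (- (1 - \<theta>) * p i)" for i
  have wv0: "0 \<le> w i" "0 \<le> v i" for i using \<mu>(1)[of i] by (auto simp: w_def v_def)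
  have bA: "b i \<in> A0" "b i \<in> A1" for i using b[of i] by (auto simp: block_at_def)
  have uA: "u i \<in> A0" "u i \<in> A1" for i
    using bA X0.subspace X1.subspace by (auto simp: u_def intro: subspace_scale)
  have n0u: "n0 (u i) \<le> B * w i" for i
    using mult_left_mono[of "n0 (b i)" "B * 2 powr (\<theta> * p i)" "\<mu> i"] b[of i] \<mu>(1)[of i]
    by (simp add: u_def w_def X0.scale[OF bA(1)] block_at_def mult_ac)
  have n1u: "n1 (u i) \<le> B * v i" for i
    using mult_left_mono[of "n1 (b i)" "B * 2 powr (- (1 - \<theta>) * p i)" "\<mu> i"] b[of i] \<mu>(1)[of i]
    by (simp add: u_def v_def X1.scale[OF bA(2)] block_at_def mult_ac)
  have Ku: "c * w i \<le> K (u i) (2 powr p i)" for i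
    using mult_left_mono[of "c * 2 powr (\<theta> * p i)" "K (b i) (2 powr p i)" "\<mu> i"] b[of i] \<mu>(1)[of i]
    by (simp add: u_def w_def K_scale[OF sum_space0[OF bA(1)]] block_at_def mult_ac)
  have step: "p i + real N \<le> p (Suc i)" for i using p(2)[of i] by linarith
  have w_step: "w i \<le> \<kappa> * w (Suc i)" for i
  proof -
    have "\<delta> * N \<le> \<theta> * N" using \<delta> by (intro mult_right_mono) auto
    moreover have "\<theta> * (p i + real N) \<le> \<theta> * p (Suc i)" using step \<theta> by (intro mult_left_mono) auto
    ultimately have "\<theta> * p i \<le> - \<delta> * N + \<theta> * p (Suc i)" by (simp add: algebra_simps)
    then have "2 powr (\<theta> * p i) \<le> 2 powr (- \<delta> * N) * 2 powr (\<theta> * p (Suc i))"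
      by (simp flip: powr_add)
    then have "w i \<le> (Q * \<mu> (Suc i)) * (2 powr (- \<delta> * N) * 2 powr (\<theta> * p (Suc i)))"
      unfolding w_def using \<mu>(3)[of i] \<mu>(1)[of i] by (intro mult_mono) auto
    also have "\<dots> = (Q * 2 powr (- \<delta> * N)) * w (Suc i)" by (simp add: w_def)
    also have "\<dots> \<le> \<kappa> * w (Suc i)" using gap wv0 by (intro mult_right_mono)
    finally show ?thesis .
  qed
  have v_step: "v (Suc i) \<le> \<kappa> * v i" for i
  proof -
    have "\<delta> * N \<le> (1 - \<theta>) * N" using \<delta> by (intro mult_right_mono) auto
    moreover have "(1 - \<theta>) * (p i + real N) \<le> (1 - \<theta>) * p (Suc i)" using step \<theta> by (intro mult_left_mono) auto
    ultimately have "- (1 - \<theta>) * p (Suc i) \<le> - \<delta> * N + - (1 - \<theta>) * p i" by (simp add: algebra_simps)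
    then have "2 powr (- (1 - \<theta>) * p (Suc i)) \<le> 2 powr (- \<delta> * N) * 2 powr (- (1 - \<theta>) * p i)"
      by (simp flip: powr_add)
    then have "v (Suc i) \<le> \<mu> i * (2 powr (- \<delta> * N) * 2 powr (- (1 - \<theta>) * p i))"
      unfolding v_def using \<mu>(2)[of i] \<mu>(1)[of i] by (intro mult_mono) auto
    also have "\<dots> = 2 powr (- \<delta> * N) * v i" by (simp add: v_def)
    also have "\<dots> \<le> \<kappa> * v i"
    proof -
      have "1 * 2 powr (- \<delta> * N) \<le> Q * 2 powr (- \<delta> * N)" using Q by (intro mult_right_mono) auto
      then have "2 powr (- \<delta> * N) \<le> \<kappa>" using gap by linarith
      then show ?thesis using wv0 by (intro mult_right_mono)
    qed
    finally show ?thesis .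
  qed
  obtain y where y: "y \<in> A1" "\<And>m. n1 (y - sum u {..<m}) \<le> 2 * C\<^sup>2 * B * v m"
    using X1.series_limit[OF complete1, of u B v \<kappa>] uA n1u wv0 v_step \<kappa>1 B by auto
  define U where "U m = sum u {..<m}" for m
  have U0: "U m \<in> A0" "U m \<in> A1" for m
    unfolding U_def by (rule X0.sum_mem X1.sum_mem; rule uA)+
  have low: "n0 (U (Suc m)) \<le> 2 * C * B * w m" for m
    using X0.sum_le_increasing[of u B w \<kappa> m] uA n0u wv0 w_step \<kappa>1 B
    by (simp add: U_def lessThan_Suc_atMost)
  have tail: "y - U m \<in> A1" "n1 (y - U m) \<le> 2 * C\<^sup>2 * B * v m" for m
    using y U0 X1.subspace by (auto simp: U_def[symmetric] intro: subspace_diff)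
  have yS: "y \<in> A0 + A1" using y(1) by (rule sum_space1)
  have CC: "2 * C * B \<le> 2 * C\<^sup>2 * B"
    using B C mult_right_mono[of 1 C "2 * C * B"] by (simp add: power2_eq_square mult_ac)
  define c' where "c' = c / (2 * C)"
  have lower: "c' * \<mu> m \<le> f \<theta> y (p m)" for m
  proof -
    define T where "T = (2::real) powr p m"
    have T: "0 < T" by (simp add: T_def)
    have Tv: "T * v m = w m" by (simp add: T_def v_def w_def algebra_simps flip: powr_add)
    have n0U: "n0 (U m) \<le> 2 * C\<^sup>2 * B * (\<kappa> * w m)"
    proof (cases m)
      case 0
      then show ?thesis using X0.zero B C \<kappa>0 wv0(1)[of m] by (simp add: U_def)
    next
      case (Suc l)
      have "n0 (U m) \<le> 2 * C * B * w l" using low[of l] Suc by simp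
      also have "\<dots> \<le> 2 * C\<^sup>2 * B * (\<kappa> * w m)"
        using w_step[of l] wv0 CC B C Suc by (intro mult_mono) auto
      finally show ?thesis .
    qed
    have n1y: "T * n1 (y - U (Suc m)) \<le> 2 * C\<^sup>2 * B * (\<kappa> * w m)"
    proof -
      have "n1 (y - U (Suc m)) \<le> 2 * C\<^sup>2 * B * (\<kappa> * v m)"
        using tail(2)[of "Suc m"] mult_left_mono[OF v_step[of m], of "2 * C\<^sup>2 * B"] B by simp
      then have "T * n1 (y - U (Suc m)) \<le> T * (2 * C\<^sup>2 * B * (\<kappa> * v m))"
        using T by (intro mult_left_mono) auto
      also have "\<dots> = 2 * C\<^sup>2 * B * (\<kappa> * (T * v m))" by (simp add: mult_ac)
      finally show ?thesis by (simp add: Tv)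
    qed
    \<comment> \<open>\<open>u m\<close> is \<open>y\<close> without the earlier blocks and without
      the tail, that is \<open>y + z\<close>. The quasi-triangle inequality then bounds
      \<open>K y T\<close> from below.\<close>
    define z where "z = - U m + - (y - U (Suc m))"
    have zS: "z \<in> A0 + A1" unfolding z_def
      using U0 tail X0.subspace X1.subspace by (intro set_plus_intro subspace_neg)
    have "K z T \<le> n0 (- U m) + T * n1 (- (y - U (Suc m)))" unfolding z_def
      using U0 tail X0.subspace X1.subspace T by (intro K_le subspace_neg)
    also have "\<dots> = n0 (U m) + T * n1 (y - U (Suc m))"
      using X0.minus[OF U0(1)] X1.minus[OF tail(1)] by simp
    also have "\<dots> \<le> 2 * C\<^sup>2 * B * (\<kappa> * w m) + 2 * C\<^sup>2 * B * (\<kappa> * w m)"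
      using n0U n1y by (rule add_mono)
    finally have "K z T \<le> 4 * C\<^sup>2 * B * \<kappa> * w m" by (simp add: mult_ac)
    then have "C * K z T \<le> C * (4 * C\<^sup>2 * B * \<kappa> * w m)" using C by (intro mult_left_mono) auto
    also have "\<dots> = (8 * C ^ 3 * B * \<kappa>) * w m / 2" by (simp add: power2_eq_square power3_eq_cube)
    also have "\<dots> \<le> c * w m / 2" using \<kappa>2 wv0(1)[of m] by (intro divide_right_mono mult_right_mono) auto
    finally have Kz: "C * K z T \<le> c * w m / 2" .
    have "u m = y + z" by (simp add: z_def U_def)
    then have "c * w m \<le> C * (K y T + K z T)"
      using Ku[of m] K_add[OF yS zS T] by (simp add: T_def)
    then have "c * w m / 2 \<le> C * K y T" using Kz by (simp add: algebra_simps)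
    then have "c' * w m \<le> K y T" using C by (simp add: c'_def field_simps)
    also have "K y T = 2 powr (\<theta> * p m) * f \<theta> y (p m)" unfolding T_def by (rule K_eq_f)
    finally have "2 powr (\<theta> * p m) * (c' * \<mu> m) \<le> 2 powr (\<theta> * p m) * f \<theta> y (p m)" by (simp add: w_def mult_ac)
    then show ?thesis by simp
  qed
  define D where "D = 4 * C\<^sup>2 * B"
  have upper: "\<exists>i. f \<theta> y k \<le> D * (\<mu> i * 2 powr (- \<delta> * \<bar>real_of_int (k - p i)\<bar>))" for k
  proof -
    define T where "T = (2::real) powr k"
    have T: "0 < T" by (simp add: T_def)
    define e where "e i = \<mu> i * 2 powr (- \<delta> * \<bar>real_of_int (k - p i)\<bar>)" for i
    have e0: "0 \<le> e i" for i using \<mu>(1)[of i] by (simp add: e_def)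
    have wle: "w i \<le> 2 powr (\<theta> * k) * e i" if "p i \<le> k" for i
    proof -
      have "\<delta> * (k - p i) \<le> \<theta> * (k - p i)" using \<delta> that by (intro mult_right_mono) auto
      then have "\<theta> * p i \<le> \<theta> * k + - \<delta> * \<bar>real_of_int (k - p i)\<bar>" using that by (simp add: algebra_simps)
      then have "2 powr (\<theta> * p i) \<le> 2 powr (\<theta> * k) * 2 powr (- \<delta> * \<bar>real_of_int (k - p i)\<bar>)"
        by (simp flip: powr_add)
      from mult_left_mono[OF this, of "\<mu> i"] show ?thesis using \<mu>(1)[of i] by (simp add: w_def e_def mult_ac)
    qed
    have vle: "T * v i \<le> 2 powr (\<theta> * k) * e i" if "k < p i" for i
    proof -
      have "\<delta> * (p i - k) \<le> (1 - \<theta>) * (p i - k)" using \<delta> that by (intro mult_right_mono) auto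
      then have "k + - (1 - \<theta>) * p i \<le> \<theta> * k + - \<delta> * \<bar>real_of_int (k - p i)\<bar>" using that by (simp add: algebra_simps)
      then have "2 powr (k + - (1 - \<theta>) * p i) \<le> 2 powr (\<theta> * k + - \<delta> * \<bar>real_of_int (k - p i)\<bar>)"
        by simp
      then have "T * 2 powr (- (1 - \<theta>) * p i) \<le> 2 powr (\<theta> * k) * 2 powr (- \<delta> * \<bar>real_of_int (k - p i)\<bar>)"
        by (simp only: T_def powr_add)
      from mult_left_mono[OF this, of "\<mu> i"] show ?thesis using \<mu>(1)[of i] by (simp add: v_def e_def mult_ac)
    qed
    have ex: "\<exists>m. k < p m"
    proof -
      have "p 0 + int m \<le> p m" for m
        by (induction m) (use p(2) in \<open>auto, smt (verit) of_nat_0_le_iff\<close>)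
      from this[of "nat (k - p 0 + 1)"] show ?thesis by (intro exI[of _ "nat (k - p 0 + 1)"]) linarith
    qed
    \<comment> \<open>The blocks with peaks up to \<open>k\<close> go to the \<open>A0\<close> part
      and all later ones to the \<open>A1\<close> part.\<close>
    define m where "m = (LEAST m. k < p m)"
    have m: "k < p m" unfolding m_def using ex by (rule LeastI_ex)
    have m': "p l \<le> k" if "l < m" for l using not_less_Least[of l "\<lambda>m. k < p m"] that by (simp add: m_def)
    have n0U: "\<exists>i. n0 (U m) \<le> 2 * C\<^sup>2 * B * (2 powr (\<theta> * k) * e i)"
    proof (cases m)
      case 0
      then show ?thesis using X0.zero B C e0 by (intro exI[of _ 0]) (simp add: U_def)
    next
      case (Suc l)
      have "n0 (U m) \<le> 2 * C * B * w l" using low[of l] Suc by simp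
      also have "\<dots> \<le> 2 * C\<^sup>2 * B * (2 powr (\<theta> * k) * e l)"
        using wle[OF m'[of l]] wv0 CC B C Suc by (intro mult_mono) auto
      finally show ?thesis by blast
    qed
    then obtain i where i: "n0 (U m) \<le> 2 * C\<^sup>2 * B * (2 powr (\<theta> * k) * e i)" by blast
    have n1y: "T * n1 (y - U m) \<le> 2 * C\<^sup>2 * B * (2 powr (\<theta> * k) * e m)"
    proof -
      have "T * n1 (y - U m) \<le> T * (2 * C\<^sup>2 * B * v m)"
        using tail(2)[of m] T by (intro mult_left_mono) auto
      also have "\<dots> = 2 * C\<^sup>2 * B * (T * v m)" by simp
      also have "\<dots> \<le> 2 * C\<^sup>2 * B * (2 powr (\<theta> * k) * e m)"
        using vle[OF m] B by (intro mult_left_mono) auto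
      finally show ?thesis .
    qed
    \<comment> \<open>Both parts are charged to the higher of two bumps, which doubles the constant
      to \<open>D\<close>.\<close>
    define j where "j = (if e i \<le> e m then m else i)"
    have j: "e i \<le> e j" "e m \<le> e j" by (auto simp: j_def)
    have "K y T = K (U m + (y - U m)) T" by simp
    also have "\<dots> \<le> n0 (U m) + T * n1 (y - U m)" using U0 tail T by (intro K_le)
    also have "\<dots> \<le> 2 * C\<^sup>2 * B * (2 powr (\<theta> * k) * e j) + 2 * C\<^sup>2 * B * (2 powr (\<theta> * k) * e j)"
    proof (rule add_mono)
      have "2 * C\<^sup>2 * B * (2 powr (\<theta> * k) * e i) \<le> 2 * C\<^sup>2 * B * (2 powr (\<theta> * k) * e j)"
        "2 * C\<^sup>2 * B * (2 powr (\<theta> * k) * e m) \<le> 2 * C\<^sup>2 * B * (2 powr (\<theta> * k) * e j)"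
        using j B by (auto intro!: mult_left_mono)
      then show "n0 (U m) \<le> 2 * C\<^sup>2 * B * (2 powr (\<theta> * k) * e j)"
        "T * n1 (y - U m) \<le> 2 * C\<^sup>2 * B * (2 powr (\<theta> * k) * e j)"
        using i n1y by linarith+
    qed
    also have "\<dots> = 2 powr (\<theta> * k) * (D * e j)" by (simp add: D_def)
    also have "K y T = 2 powr (\<theta> * k) * f \<theta> y k" unfolding T_def by (rule K_eq_f)
    finally have "f \<theta> y k \<le> D * e j" by simp
    then show ?thesis unfolding e_def by blast
  qed
  show ?thesis
    by (rule that[OF y(1) _ _ \<delta>(1) _ lower upper])
      (use B C mono_p in \<open>auto simp: c'_def D_def strict_mono_imp_inj_on\<close>)
qed

text \<open>The upper envelope puts \<open>f \<theta> y\<close> into the sequence space for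
  \<open>r2\<close>; the lower bounds at the distinct positions \<open>p i\<close> would put
  \<open>\<mu>\<close> into the one for \<open>r1\<close>, where it does not lie.\<close>

lemma exists_separating_element:
  assumes \<theta>: "0 < \<theta>" "\<theta> < 1" and B: "0 < B" "0 < c" and r: "0 < r1" "r1 < r2"
    and P: "\<And>p. p \<in> P \<Longrightarrow> \<exists>b. block_at \<theta> B c p b" "\<And>m. \<exists>p\<in>P. m \<le> p"
  shows "\<exists>y\<in>A0 + A1. mem_ell r2 (f \<theta> y) UNIV \<and> \<not> mem_ell r1 (f \<theta> y) UNIV"
proof -
  define s where "s = enn2real r1"
  define \<mu> where "\<mu> i = real (Suc i) powr (- 1 / s)" for i
  have "r1 \<noteq> \<infinity>" using r by auto
  then have s: "0 < s"
    using r by (simp add: s_def enn2real_positive_iff top.not_eq_extremum)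
  have \<mu>: "0 < \<mu> i" "\<mu> (Suc i) \<le> \<mu> i" "\<mu> i \<le> 2 powr (1 / s) * \<mu> (Suc i)" for i
  proof -
    show "0 < \<mu> i" by (simp add: \<mu>_def)
    show "\<mu> (Suc i) \<le> \<mu> i" unfolding \<mu>_def using s by (intro powr_mono2') auto
    \<comment> \<open>The ratio bound rests on \<open>i + 2 \<le> 2 * (i + 1)\<close>.\<close>
    have "(2 * real (Suc i)) powr (- 1 / s) = 2 powr (- 1 / s) * \<mu> i"
      unfolding \<mu>_def by (rule powr_mult)
    then have "\<mu> i = 2 powr (1 / s) * (2 * real (Suc i)) powr (- 1 / s)"
      by (simp flip: powr_add mult.assoc)
    also have "\<dots> \<le> 2 powr (1 / s) * \<mu> (Suc i)"
      unfolding \<mu>_def using s by (intro mult_left_mono powr_mono2') auto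
    finally show "\<mu> i \<le> 2 powr (1 / s) * \<mu> (Suc i)" .
  qed
  obtain y c' D \<delta> and p :: "nat \<Rightarrow> int" where
    y: "y \<in> A1" "0 < c'" "0 \<le> D" "0 < \<delta>" "inj p" "\<And>i. c' * \<mu> i \<le> f \<theta> y (p i)"
      "\<And>k. \<exists>i. f \<theta> y k \<le> D * (\<mu> i * 2 powr (- \<delta> * \<bar>real_of_int (k - p i)\<bar>))"
    using gliding_sum[of \<theta> B c P \<mu> "2 powr (1 / s)", OF \<theta> B P \<mu>] by blast
  have yS: "y \<in> A0 + A1" using y(1) by (rule sum_space1)
  have \<mu>1: "\<not> mem_ell r1 \<mu> UNIV" and \<mu>2: "mem_ell r2 \<mu> UNIV"
    using mem_ell_inverse_powr[OF r] by (simp_all add: \<mu>_def[abs_def] s_def)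
  have "mem_ell r2 (f \<theta> y) UNIV"
    using r by (intro mem_ell_envelope[where g = \<mu> and I = UNIV and p = p, OF _ _ y(4,3) _ _ \<mu>2])
      (use y(7) \<mu>(1) f_nonneg[OF yS] in \<open>auto intro: less_imp_le\<close>)
  moreover have "\<not> mem_ell r1 (f \<theta> y) UNIV"
  proof
    assume "mem_ell r1 (f \<theta> y) UNIV"
    then have "mem_ell r1 \<mu> UNIV"
      using y(2,6) \<mu>(1) f_nonneg[OF yS] r
      by (intro mem_ell_comparison[where h = p and D = "inverse c'", OF _ r(1) y(5)])
        (auto simp: field_simps intro: less_imp_le)
    with \<mu>1 show False ..
  qed
  ultimately show ?thesis using yS by blast
qed

section \<open>Exchanging the two spaces, and separation from arbitrary peaks\<close>

lemma swap: "quasi_couple A1 A0 n1 n0 C"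
  by (intro quasi_couple.intro quasi_couple_axioms.intro complete0 complete1)
    (rule X1.quasi_normed_axioms X0.quasi_normed_axioms)+

text \<open>One inequality suffices: applied to the exchanged couple at time \<open>1 / t\<close> it
  yields the converse.\<close>

lemma K_swap_le:
  assumes x: "x \<in> A0 + A1" and t: "0 < t"
  shows "K_functional A1 n1 A0 n0 x t \<le> t * K x (1 / t)"
proof -
  interpret S: quasi_couple A1 A0 n1 n0 C by (rule swap)
  have "S.K x t / t \<le> K x (1 / t)"
  proof (rule K_greatest[OF x])
    fix a0 a1 assume a: "a0 \<in> A0" "a1 \<in> A1" "x = a0 + a1"
    have "S.K x t \<le> n1 a1 + t * n0 a0"
      using S.K_le[OF a(2,1) t] a(3) by (simp add: add.commute)
    then show "S.K x t / t \<le> n0 a0 + 1 / t * n1 a1" using t by (simp add: field_simps)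
  qed
  then show ?thesis using t by (simp add: field_simps)
qed

text \<open>The exchange reflects the index, so peaks running to minus infinity become peaks running
  to plus infinity.\<close>

lemma f_swap:
  assumes x: "x \<in> A0 + A1"
  shows "dyadic_K A1 n1 A0 n0 (1 - \<theta>) x k = f \<theta> x (- k)"
proof -
  interpret S: quasi_couple A1 A0 n1 n0 C by (rule swap)
  define t where "t = (2::real) powr k"
  have t: "0 < t" by (simp add: t_def)
  have x': "x \<in> A1 + A0" using x by (simp add: add.commute)
  have "K x (1 / t) \<le> (1 / t) * S.K x t"
    using S.K_swap_le[OF x', of "1 / t"] t by simp
  then have "S.K x t = t * K x (1 / t)"
    using K_swap_le[OF x t] t by (simp add: field_simps)
  then have "dyadic_K A1 n1 A0 n0 (1 - \<theta>) x k = 2 powr (- (1 - \<theta>) * k) * 2 powr k * K x (2 powr (- k))"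
    by (simp add: dyadic_K_def t_def powr_minus field_simps)
  also have "2 powr (- (1 - \<theta>) * k) * 2 powr k = 2 powr (- \<theta> * (- k))"
    by (simp add: algebra_simps flip: powr_add)
  finally show ?thesis by (simp add: dyadic_K_def)
qed

lemma separation_of_unbounded_peaks:
  assumes \<theta>: "0 < \<theta>" "\<theta> < 1" and r: "0 < r1" "r1 < r2"
    and x: "x \<in> A0 + A1" and pos: "\<And>k. 0 < f \<theta> x k"
    and unb: "\<And>m. \<exists>p\<ge>m. peak (min \<theta> (1 - \<theta>) / 2) (f \<theta> x) p"
  shows "\<exists>y\<in>A0 + A1. mem_ell r2 (f \<theta> y) UNIV \<and> \<not> mem_ell r1 (f \<theta> y) UNIV"
proof -
  obtain B c where B: "0 < B" "0 < c"
    "\<And>p. peak (min \<theta> (1 - \<theta>) / 2) (f \<theta> x) p \<Longrightarrow> \<exists>b. block_at \<theta> B c p b"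
    using block_at_peak[OF x \<theta> pos refl] by blast
  show ?thesis
    by (rule exists_separating_element[OF \<theta> B(1,2) r, of "{p. peak (min \<theta> (1 - \<theta>) / 2) (f \<theta> x) p}"])
      (use B(3) unb in auto)
qed

text \<open>The role of \<open>x\<close> is to provide infinitely many peaks. From these, elements
  can be built for any prescribed pair \<open>r1 < r2\<close>, whatever the order of
  \<open>p\<close> and \<open>q\<close>.\<close>

lemma separation:
  assumes \<theta>: "0 < \<theta>" "\<theta> < 1" and r: "0 < r1" "r1 < r2"
    and x: "x \<in> A0 + A1" "mem_ell p (f \<theta> x) UNIV" "\<not> mem_ell q (f \<theta> x) UNIV"
    and pq: "0 < p" "0 < q"
  shows "\<exists>y\<in>A0 + A1. mem_ell r2 (f \<theta> y) UNIV \<and> \<not> mem_ell r1 (f \<theta> y) UNIV"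
proof -
  define \<eta> where "\<eta> = min \<theta> (1 - \<theta>) / 2"
  have \<eta>: "0 < \<eta>" using \<theta> by (simp add: \<eta>_def)
  have "\<exists>k. f \<theta> x k \<noteq> 0"
  proof (rule ccontr)
    assume "\<not> ?thesis"
    then have "f \<theta> x = (\<lambda>_. 0)" by auto
    moreover have "mem_ell q (\<lambda>_::int. 0) UNIV"
      by (cases "q = \<infinity>") (auto simp: mem_ell_def bdd_above_def)
    ultimately show False using x(3) by simp
  qed
  then have pos: "0 < f \<theta> x k" for k using f_pos[OF x(1)] by blast
  have bdd: "bdd_above (range (f \<theta> x))" using mem_ell_bdd_above[OF pq(1) x(2)] .
  have "infinite {k. peak \<eta> (f \<theta> x) k}"
    using finitely_many_peaks_mem_ell[OF pos bdd \<eta> _ pq(2)] x(3) by blast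
  \<comment> \<open>An infinite set of integers is unbounded above or below.\<close>
  then have "(\<forall>m. \<exists>k\<ge>m. peak \<eta> (f \<theta> x) k) \<or> (\<forall>m. \<exists>k\<ge>m. peak \<eta> (f \<theta> x) (- k))"
  proof (rule contrapos_np)
    assume "\<not> ?thesis"
    then obtain m m' where m: "\<And>k. m \<le> k \<Longrightarrow> \<not> peak \<eta> (f \<theta> x) k" "\<And>k. m' \<le> k \<Longrightarrow> \<not> peak \<eta> (f \<theta> x) (- k)"
      by blast
    have "{k. peak \<eta> (f \<theta> x) k} \<subseteq> {- m'..m}"
    proof
      fix k assume "k \<in> {k. peak \<eta> (f \<theta> x) k}"
      then show "k \<in> {- m'..m}" using m(1)[of k] m(2)[of "- k"] by force
    qed
    then show "finite {k. peak \<eta> (f \<theta> x) k}" by (rule finite_subset) simp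
  qed
  then show ?thesis
  proof
    assume "\<forall>m. \<exists>k\<ge>m. peak \<eta> (f \<theta> x) k"
    then show ?thesis using separation_of_unbounded_peaks[OF \<theta> r x(1) pos] by (auto simp: \<eta>_def)
  next
    assume neg: "\<forall>m. \<exists>k\<ge>m. peak \<eta> (f \<theta> x) (- k)"
    interpret S: quasi_couple A1 A0 n1 n0 C by (rule swap)
    have x': "x \<in> A1 + A0" using x(1) by (simp add: add.commute)
    have eq: "S.f (1 - \<theta>) x = (\<lambda>k. f \<theta> x (- k))" using f_swap[OF x(1)] by auto
    have "peak \<eta> (S.f (1 - \<theta>) x) k" if k: "peak \<eta> (f \<theta> x) (- k)" for k
      unfolding eq peak_def
    proof
      fix j
      have "\<bar>real_of_int (- j - - k)\<bar> = \<bar>real_of_int (j - k)\<bar>" by simp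
      then show "f \<theta> x (- j) * 2 powr (- \<eta> * \<bar>real_of_int (j - k)\<bar>) \<le> f \<theta> x (- k)"
        using k unfolding peak_def by metis
    qed
    \<comment> \<open>The rate \<open>\<eta>\<close> is symmetric in \<open>\<theta>\<close> and
      \<open>1 - \<theta>\<close>, so peaks stay peaks for the exchanged couple.\<close>
    then have "\<exists>k\<ge>m. peak (min (1 - \<theta>) (1 - (1 - \<theta>)) / 2) (S.f (1 - \<theta>) x) k" for m
      using neg by (simp add: \<eta>_def min.commute) blast
    then obtain y where y: "y \<in> A1 + A0" "mem_ell r2 (S.f (1 - \<theta>) y) UNIV" "\<not> mem_ell r1 (S.f (1 - \<theta>) y) UNIV"
      using S.separation_of_unbounded_peaks[of "1 - \<theta>", OF _ _ r x'] \<theta> pos by (auto simp: eq)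
    have y': "y \<in> A0 + A1" using y(1) by (simp add: add.commute)
    have "mem_ell r (S.f (1 - \<theta>) y) UNIV \<longleftrightarrow> mem_ell r (f \<theta> y) UNIV" for r
      using mem_ell_reindex[OF bij_uminus, of r "f \<theta> y"] f_swap[OF y', abs_def] by simp
    then show ?thesis using y y' by blast
  qed
qed

end

section \<open>The theorem for a quasi-Banach couple\<close>

lemma quasi_couple_of_quasi_Banach:
  assumes 0: "quasi_Banach A0 n0" and 1: "quasi_Banach A1 n1"
  obtains C where "quasi_couple A0 A1 n0 n1 C"
proof -
  have q: "quasi_norm_on A0 n0" "quasi_norm_on A1 n1"
    using assms by (auto simp: quasi_Banach_def)
  then have "\<exists>C0\<ge>1. \<forall>x\<in>A0. \<forall>y\<in>A0. n0 (x + y) \<le> C0 * (n0 x + n0 y)"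
    "\<exists>C1\<ge>1. \<forall>x\<in>A1. \<forall>y\<in>A1. n1 (x + y) \<le> C1 * (n1 x + n1 y)"
    by (simp_all only: quasi_norm_on_def)
  then obtain C0 C1 where C: "1 \<le> C0" "\<forall>x\<in>A0. \<forall>y\<in>A0. n0 (x + y) \<le> C0 * (n0 x + n0 y)"
    "\<forall>x\<in>A1. \<forall>y\<in>A1. n1 (x + y) \<le> C1 * (n1 x + n1 y)"
    by (elim exE conjE)
  have normed: "quasi_normed A n (max C0 C1)"
    if q: "quasi_norm_on A n" and C': "\<forall>x\<in>A. \<forall>y\<in>A. n (x + y) \<le> C' * (n x + n y)" "C' \<le> max C0 C1" for A n C'
  proof
    fix x y assume xy: "x \<in> A" "y \<in> A"
    have "C' * (n x + n y) \<le> max C0 C1 * (n x + n y)"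
      using q C'(2) xy by (intro mult_right_mono) (auto simp: quasi_norm_on_def)
    then show "n (x + y) \<le> max C0 C1 * (n x + n y)" using C'(1) xy by (meson order_trans)
  qed (use q C(1) in \<open>auto simp: quasi_norm_on_def\<close>)
  have "quasi_couple A0 A1 n0 n1 (max C0 C1)"
    by (intro quasi_couple.intro quasi_couple_axioms.intro 0 1 normed[OF q(1) C(2)] normed[OF q(2) C(3)]) auto
  then show ?thesis by (rule that)
qed

theorem theorem2p10:
  fixes A0 A1 :: "'v::hausdorff_real_tvs set"
    and n0 n1 :: "'v \<Rightarrow> real"
    and \<theta> :: real
    and p q r1 r2 :: ennreal
  assumes "quasi_Banach_couple A0 n0 A1 n1"
    and "\<not> closedin (quasi_norm_topology (A0 + A1) (sum_quasi_norm A0 n0 A1 n1)) (A0 \<inter> A1)"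
    and "0 < \<theta>" and "\<theta> < 1"
    and "0 < p" and "0 < q"
    and "interp_space A0 n0 A1 n1 \<theta> p \<noteq> interp_space A0 n0 A1 n1 \<theta> q"
    and "r1 \<in> {q..p}" and "r2 \<in> {q..p}" and "r1 \<noteq> r2"
  shows "interp_space A0 n0 A1 n1 \<theta> r1 \<noteq> interp_space A0 n0 A1 n1 \<theta> r2"
proof -
  obtain C where "quasi_couple A0 A1 n0 n1 C"
    using assms(1) quasi_couple_of_quasi_Banach[of A0 n0 A1 n1] by (auto simp: quasi_Banach_couple_def)
  then interpret quasi_couple A0 A1 n0 n1 C .
  note iff = interp_space_iff[OF assms(3)]
  \<comment> \<open>\<open>p'\<close> and \<open>q'\<close> are \<open>p\<close> and
    \<open>q\<close> in the order in which the first space contains an element outside the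
    second.\<close>
  obtain x p' q' where x: "x \<in> A0 + A1" "mem_ell p' (f \<theta> x) UNIV" "\<not> mem_ell q' (f \<theta> x) UNIV"
    and pq: "0 < p'" "0 < q'"
    using assms(5-7) iff[OF assms(5)] iff[OF assms(6)] by blast
  have "interp_space A0 n0 A1 n1 \<theta> s1 \<noteq> interp_space A0 n0 A1 n1 \<theta> s2" if s: "0 < s1" "s1 < s2" for s1 s2
    using separation[OF assms(3,4) s x pq] iff[of s1] iff[of s2] s by (metis order_less_trans)
  moreover have "0 < r1" "0 < r2" using assms(6,8,9) by (auto intro: less_le_trans)
  ultimately show ?thesis using assms(10) by (metis linorder_neqE)
qed

end
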